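(* Let $\ell\ge 1$ and $g\ge 0$ be integers with $\ell-2g\ge 1$, and put $f=\ell-2g+1$. There exists a normal crossings divisor $\hat\Sigma_{\ell,g}\subset\mathbb{A}^{\ell^2}$, which is a union of $N=\binom{f}{2}$ linear spaces, $$\hat\Sigma_{\ell,g}:=X_1\cup\cdots\cup X_N,$$ such that for all graphs $\Gamma$ with $\ell$ loops and a closed 2-cell embedding in an orientable surface of genus $g$ (with at least 3 vertices, no looping edges, and such that any two of the faces have at most one edge in common), the preimage under $\tau=\tau_\Gamma$ of the union $\hat\Sigma_\Gamma$ of a subset of components of $\hat\Sigma_{\ell,g}$ is the algebraic simplex $\Sigma_n=\{t\in\mathbb{A}^n: t_1\cdots t_n=0\}$ in $\mathbb{A}^n$, where $n$ is the number of edges of $\Gamma$. More explicitly, the divisor $\hat\Sigma_{\ell,g}$ can be described by the $N=\binom f2$ equations $$x_{ij}=0\quad(1\le i<j\le f-1),\qquad x_{i1}+\cdots+x_{i,f-1}=0\quad(1\le i\le f-1),$$ where $f=\ell-2g+1$ is the number of faces of the embedding.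
   Context: $\mathbb{A}^{\ell^2}$ is the affine space of $\ell\times\ell$ matrices $x=(x_{ij})$. Graphs are finite and connected (multigraphs allowed); a looping edge is an edge whose two ends coincide; the number of loops of $\Gamma$ is $\ell=b_1(\Gamma)$. An embedding of $\Gamma$ in a compact orientable surface $S$ is a closed 2-cell embedding if $S\smallsetminus\Gamma$ is a disjoint union of open 2-cells (the faces) and the closure of every face is a disk. If $S$ has genus $g$ then the number $f$ of faces satisfies $\ell=2g+f-1$. Given such an embedding, choose one face as the external face. Fix orientations of the edges $e_1,\dots,e_n$, and take as basis $l_1,\dots,l_\ell$ of $H_1(\Gamma,\mathbb{Z})$ the boundaries $l_1,\dots,l_{f-1}$ of the $f-1$ remaining (internal) faces, each with the positive (counterclockwise) orientation, followed by $2g$ loops in $\Gamma$ representing a basis of $H_1(S,\mathbb{Z})$. Let $\eta$ be the $n\times\ell$ matrix with $\eta_{ik}=\pm1$ if $e_i$ belongs to $l_k$ with the same, resp. reverse, orientation, and $0$ otherwise; let $\Lambda=\mathrm{diag}(t_1,\dots,t_n)$. The map $\tau_\Gamma:\mathbb{A}^n\to\mathbb{A}^{\ell^2}$ is $\tau_\Gamma(t)=\eta^\dagger\Lambda\eta$ ($\dagger$ = transpose).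
   Formalization: Each face is required to be the interior of the closed disk that is its closure; if only the closure must be a disk, a pendant edge inside a face is allowed, its row of η vanishes, and the claim about the preimage fails. *)

theory Defs
  imports
    "HOL-Complex_Analysis.Complex_Analysis"
    "HOL-Homology.Homology"
    "Graph_Theory.Graph_Theory"
    "Jordan_Normal_Form.Matrix"
begin

section \<open>Oriented surfaces\<close>

text \<open>
  Intended for \<open>h\<close> continuous and injective on the open set \<open>D\<close>: the image of a
  counterclockwise circle around \<open>z\<close> then winds around \<open>h z\<close> exactly once, in the
  positive or in the negative sense.
\<close>

definition orientation_preserving :: "complex set \<Rightarrow> (complex \<Rightarrow> complex) \<Rightarrow> bool" where
  "orientation_preserving D h \<longleftrightarrow>
     (\<forall>z r. 0 < r \<and> cball z r \<subseteq> D \<longrightarrow> winding_number (h \<circ> circlepath z r) (h z) = 1)"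

definition chart :: "'a topology \<Rightarrow> 'a set \<Rightarrow> ('a \<Rightarrow> complex) \<Rightarrow> bool" where
  "chart S U c \<longleftrightarrow>
     openin S U \<and> open (c ` U) \<and> homeomorphic_map (subtopology S U) (top_of_set (c ` U)) c"

text \<open>
  A compact connected topological surface without boundary, oriented by the atlas \<open>\<A>\<close>;
  a surface is orientable iff it has such an atlas. Second countability follows from
  compactness.
\<close>

definition oriented_surface :: "'a topology \<Rightarrow> ('a set \<times> ('a \<Rightarrow> complex)) set \<Rightarrow> bool" where
  "oriented_surface S \<A> \<longleftrightarrow>
     compact_space S \<and> connected_space S \<and> Hausdorff_space S \<and>
     (\<forall>(U, c) \<in> \<A>. chart S U c) \<and>
     (\<Union>(U, c) \<in> \<A>. U) = topspace S \<and>
     (\<forall>(U, c) \<in> \<A>. \<forall>(V, d) \<in> \<A>.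
        orientation_preserving (c ` (U \<inter> V)) (d \<circ> inv_into U c))"

text \<open>Stated for spaces with free first homology, such as graphs and orientable surfaces.\<close>

definition has_first_betti_number :: "'a topology \<Rightarrow> nat \<Rightarrow> bool" where
  "has_first_betti_number X r \<longleftrightarrow> homology_group 1 X \<cong> free_Abelian_group {..<r}"

definition has_genus :: "'a topology \<Rightarrow> nat \<Rightarrow> bool" where
  "has_genus S g \<longleftrightarrow> has_first_betti_number S (2 * g)"


section \<open>Loops and bases of the first homology\<close>

text \<open>
  A loop is a function on the unit circle of the complex plane, run through
  counterclockwise; its values off the circle play no role.
\<close>

definition loop_class ::
    "'a topology \<Rightarrow> (complex \<Rightarrow> 'a) \<Rightarrow> (((nat \<Rightarrow> real) \<Rightarrow> 'a) \<Rightarrow>\<^sub>0 int) set" where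
  "loop_class X l =
     homologous_rel_set 1 X {}
       (frag_of (restrict (\<lambda>x. l (cis (2 * pi * x 1))) (standard_simplex 1)))"

definition integral_basis :: "('c, 'd) monoid_scheme \<Rightarrow> 'i set \<Rightarrow> ('i \<Rightarrow> 'c) \<Rightarrow> bool" where
  "integral_basis H I b \<longleftrightarrow>
     finite I \<and> b ` I \<subseteq> carrier H \<and>
     (\<forall>x \<in> carrier H. \<exists>!m :: 'i \<Rightarrow> int.
        m \<in> I \<rightarrow>\<^sub>E UNIV \<and> x = (\<Otimes>\<^bsub>H\<^esub>k\<in>I. b k [^]\<^bsub>H\<^esub> m k))"

definition homology_basis :: "'a topology \<Rightarrow> nat set \<Rightarrow> (nat \<Rightarrow> complex \<Rightarrow> 'a) \<Rightarrow> bool" where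
  "homology_basis X I l \<longleftrightarrow>
     integral_basis (homology_group 1 X) I (\<lambda>k. loop_class X (l k))"


section \<open>Embedded graphs\<close>

text \<open>
  Finite multigraphs with oriented edges are finite digraphs in the sense of
  \<open>fin_digraph\<close>. An embedding consists of the images \<open>\<nu>\<close> of the vertices and of
  parametrisations \<open>\<gamma> e\<close> on \<open>[0,1]\<close> of the edges, running in the direction
  of the chosen orientation.
\<close>

definition graph_embedding ::
    "'a topology \<Rightarrow> ('v, 'e) pre_digraph \<Rightarrow> ('v \<Rightarrow> 'a) \<Rightarrow> ('e \<Rightarrow> real \<Rightarrow> 'a) \<Rightarrow> bool" where
  "graph_embedding S G \<nu> \<gamma> \<longleftrightarrow>
     inj_on \<nu> (verts G) \<and> \<nu> ` verts G \<subseteq> topspace S \<and>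
     (\<forall>e \<in> arcs G.
        pathin S (\<gamma> e) \<and> \<gamma> e 0 = \<nu> (tail G e) \<and> \<gamma> e 1 = \<nu> (head G e) \<and>
        inj_on (\<gamma> e) {0<..<1} \<and> \<gamma> e ` {0<..<1} \<inter> \<nu> ` verts G = {}) \<and>
     (\<forall>e \<in> arcs G. \<forall>e' \<in> arcs G. e \<noteq> e' \<longrightarrow> \<gamma> e ` {0<..<1} \<inter> \<gamma> e' ` {0<..<1} = {})"

definition graph_image ::
    "('v, 'e) pre_digraph \<Rightarrow> ('v \<Rightarrow> 'a) \<Rightarrow> ('e \<Rightarrow> real \<Rightarrow> 'a) \<Rightarrow> 'a set" where
  "graph_image G \<nu> \<gamma> = \<nu> ` verts G \<union> (\<Union>e \<in> arcs G. \<gamma> e ` {0..1})"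

definition faces ::
    "'a topology \<Rightarrow> ('v, 'e) pre_digraph \<Rightarrow> ('v \<Rightarrow> 'a) \<Rightarrow> ('e \<Rightarrow> real \<Rightarrow> 'a) \<Rightarrow> 'a set set" where
  "faces S G \<nu> \<gamma> = connected_components_of (subtopology S (topspace S - graph_image G \<nu> \<gamma>))"

text \<open>
  The open cell \<open>F\<close> has to be the interior of the closed disk. Requiring only that the
  closure be a disk would admit a pendant edge sticking into a face, whose two sides lie
  on the same face.
\<close>

definition closed_disk :: "'a topology \<Rightarrow> 'a set \<Rightarrow> (complex \<Rightarrow> 'a) \<Rightarrow> bool" where
  "closed_disk S F \<phi> \<longleftrightarrow>
     embedding_map (top_of_set (cball 0 1)) S \<phi> \<and>
     \<phi> ` ball 0 1 = F \<and> \<phi> ` cball 0 1 = S closure_of F"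

definition closed_2_cell_embedding ::
    "'a topology \<Rightarrow> ('v, 'e) pre_digraph \<Rightarrow> ('v \<Rightarrow> 'a) \<Rightarrow> ('e \<Rightarrow> real \<Rightarrow> 'a) \<Rightarrow> bool" where
  "closed_2_cell_embedding S G \<nu> \<gamma> \<longleftrightarrow>
     graph_embedding S G \<nu> \<gamma> \<and> (\<forall>F \<in> faces S G \<nu> \<gamma>. \<exists>\<phi>. closed_disk S F \<phi>)"

definition positively_oriented_disk ::
    "'a topology \<Rightarrow> ('a set \<times> ('a \<Rightarrow> complex)) set \<Rightarrow> 'a set \<Rightarrow> (complex \<Rightarrow> 'a) \<Rightarrow> bool" where
  "positively_oriented_disk S \<A> F \<phi> \<longleftrightarrow>
     closed_disk S F \<phi> \<and>
     (\<forall>(U, c) \<in> \<A>. orientation_preserving {z \<in> ball 0 1. \<phi> z \<in> U} (c \<circ> \<phi>))"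

definition positive_boundary ::
    "'a topology \<Rightarrow> ('a set \<times> ('a \<Rightarrow> complex)) set \<Rightarrow> 'a set \<Rightarrow> (complex \<Rightarrow> 'a) \<Rightarrow> bool" where
  "positive_boundary S \<A> F l \<longleftrightarrow>
     (\<exists>\<phi>. positively_oriented_disk S \<A> F \<phi> \<and> (\<forall>z \<in> sphere 0 1. l z = \<phi> z))"

text \<open>
  A loop may pass a vertex repeatedly, but runs through each edge at most once, so that
  its incidence number with an edge is one of 0, 1 and -1.
\<close>

definition loop_in_graph ::
    "'a topology \<Rightarrow> ('v, 'e) pre_digraph \<Rightarrow> ('v \<Rightarrow> 'a) \<Rightarrow> ('e \<Rightarrow> real \<Rightarrow> 'a) \<Rightarrow> (complex \<Rightarrow> 'a) \<Rightarrow> bool"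
  where
  "loop_in_graph S G \<nu> \<gamma> l \<longleftrightarrow>
     continuous_map (top_of_set (sphere 0 1)) S l \<and>
     l ` sphere 0 1 \<subseteq> graph_image G \<nu> \<gamma> \<and>
     (\<forall>x \<in> sphere 0 1. \<forall>y \<in> sphere 0 1. l x = l y \<longrightarrow> x = y \<or> l x \<in> \<nu> ` verts G)"

definition common_edges ::
    "'a topology \<Rightarrow> ('v, 'e) pre_digraph \<Rightarrow> ('e \<Rightarrow> real \<Rightarrow> 'a) \<Rightarrow> 'a set \<Rightarrow> 'a set \<Rightarrow> 'e set" where
  "common_edges S G \<gamma> F F' =
     {e \<in> arcs G. \<gamma> e ` {0..1} \<subseteq> S closure_of F \<inter> S closure_of F'}"

text \<open>
  \<open>F 0, ..., F (f - 2)\<close> are the internal faces and \<open>l\<close> lists their boundaries,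
  followed by \<open>2 * g\<close> further loops; here \<open>f\<close> is the number of all faces.
\<close>

definition face_loop_basis ::
    "'a topology \<Rightarrow> ('a set \<times> ('a \<Rightarrow> complex)) set \<Rightarrow> nat \<Rightarrow>
     ('v, 'e) pre_digraph \<Rightarrow> ('v \<Rightarrow> 'a) \<Rightarrow> ('e \<Rightarrow> real \<Rightarrow> 'a) \<Rightarrow>
     'a set \<Rightarrow> (nat \<Rightarrow> 'a set) \<Rightarrow> (nat \<Rightarrow> complex \<Rightarrow> 'a) \<Rightarrow> bool" where
  "face_loop_basis S \<A> g G \<nu> \<gamma> ext F l \<longleftrightarrow>
     (let f = card (faces S G \<nu> \<gamma>) in
        ext \<in> faces S G \<nu> \<gamma> \<and>
        bij_betw F {..<f - 1} (faces S G \<nu> \<gamma> - {ext}) \<and>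
        (\<forall>k < f - 1. positive_boundary S \<A> (F k) (l k)) \<and>
        (\<forall>k \<in> {f - 1..<f - 1 + 2 * g}. loop_in_graph S G \<nu> \<gamma> (l k)) \<and>
        homology_basis S {f - 1..<f - 1 + 2 * g} l \<and>
        homology_basis (subtopology S (graph_image G \<nu> \<gamma>)) {..<f - 1 + 2 * g} l)"


section \<open>The map from the edge variables to matrices\<close>

definition same_direction :: "(real \<Rightarrow> 'a) \<Rightarrow> (complex \<Rightarrow> 'a) \<Rightarrow> bool" where
  "same_direction p l \<longleftrightarrow>
     (\<exists>\<theta> :: real \<Rightarrow> real. continuous_on {0..1} \<theta> \<and> strict_mono_on {0..1} \<theta> \<and>
        (\<forall>s \<in> {0..1}. p s = l (cis (\<theta> s))))"

definition incidence :: "(real \<Rightarrow> 'a) \<Rightarrow> (complex \<Rightarrow> 'a) \<Rightarrow> int" where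
  "incidence p l =
     (if same_direction p l then 1 else if same_direction (\<lambda>s. p (1 - s)) l then -1 else 0)"

definition eta_matrix ::
    "nat \<Rightarrow> ('e \<Rightarrow> real \<Rightarrow> 'a) \<Rightarrow> 'e list \<Rightarrow> (nat \<Rightarrow> complex \<Rightarrow> 'a) \<Rightarrow> 'k :: field mat" where
  "eta_matrix ell \<gamma> es l =
     mat (length es) ell (\<lambda>(i, k). of_int (incidence (\<gamma> (es ! i)) (l k)))"

definition tau_map :: "'k :: field mat \<Rightarrow> 'k vec \<Rightarrow> 'k mat" where
  "tau_map \<eta> t = transpose_mat \<eta> * mat_diag (dim_vec t) (vec_index t) * \<eta>"


section \<open>Normal crossings\<close>

definition linear_form :: "nat \<Rightarrow> 'k :: field mat \<Rightarrow> 'k mat \<Rightarrow> 'k" where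
  "linear_form ell A x = (\<Sum>i<ell. \<Sum>j<ell. A $$ (i, j) * x $$ (i, j))"

text \<open>
  The divisor with components \<open>X 0, ..., X (N - 1)\<close> in the space of
  \<open>ell \<times> ell\<close> matrices, each component being the zero set of a linear form. The
  crossings are normal if at every point \<open>p\<close> the equations of the components through
  \<open>p\<close> are part of a system of local parameters, that is, have linearly independent
  differentials; the differential of a linear form is the form itself. In particular,
  the forms are nonzero and the components are distinct.
\<close>

definition normal_crossings_linear_divisor ::
    "nat \<Rightarrow> nat \<Rightarrow> (nat \<Rightarrow> 'k :: field mat set) \<Rightarrow> bool" where
  "normal_crossings_linear_divisor ell N X \<longleftrightarrow>
     (\<exists>A :: nat \<Rightarrow> 'k mat.
        (\<forall>k < N. A k \<in> carrier_mat ell ell \<and>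
           X k = {x \<in> carrier_mat ell ell. linear_form ell (A k) x = 0}) \<and>
        (\<forall>p \<in> carrier_mat ell ell. \<forall>c :: nat \<Rightarrow> 'k.
           (\<forall>i < ell. \<forall>j < ell. (\<Sum>k \<in> {k. k < N \<and> p \<in> X k}. c k * A k $$ (i, j)) = 0) \<longrightarrow>
           (\<forall>k < N. p \<in> X k \<longrightarrow> c k = 0)))"

end

theory Submission
  imports Defs
begin

text \<open>
  Let \<open>\<eta>(e, k)\<close> be the incidence number of the edge \<open>e\<close> and the \<open>k\<close>-th basis loop. The
  entry \<open>(i, j)\<close> of \<open>\<tau>(t)\<close> is the sum of
  \<open>\<eta>(e, i) \<eta>(e, j) t(e)\<close> over all edges \<open>e\<close>. The theorem comes down to one fact: every edge lies on
  the boundary of exactly two faces, and their positive boundaries run through the edge in opposite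
  directions (\<open>edge_faces_two\<close>, \<open>positive_boundary_incidence_opposite\<close>). Granted this, let \<open>e\<close> be
  an edge. If it separates two internal faces \<open>i < j\<close>, it is the only edge common to them, and so
  \<open>x(i, j) = - t(e)\<close>. If it separates an internal face \<open>i\<close> from the external one, consider the
  \<open>i\<close>-th row sum over the internal faces: an edge \<open>e'\<close> of the face \<open>i\<close> contributes
  \<open>\<eta>(e', i) (\<Sum>j. \<eta>(e', j)) t(e')\<close>, where the sum in brackets vanishes as soon as both faces of
  \<open>e'\<close> are internal, so that only \<open>e\<close> survives and the row sum is \<open>t(e)\<close>
  (\<open>pair_value_tau_map\<close>). Thus the equations of the components are indexed by the pairs of faces,
  and the components of those pairs that share an edge pull back to the coordinate hyperplanes, each
  hyperplane occurring once.

  The local structure at an edge rests on invariance of domain. A loop which bounds a face contains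
  an open edge or misses it, because the edge is open in the graph (\<open>edge_in_simple_loop\<close>). An
  edge on a single face would make a boundary point of a closed disk an interior point of it, and
  an edge on no face would make a segment open in the plane. Two closed disks with a common
  boundary arc can be glued along it to a map from a strip to the surface which is injective, hence
  open (\<open>glued_disks_along_arc\<close>), so that its image leaves no room for a third face. The two
  halves of the strip are carried to the two faces by maps of the form \<open>annulus_map\<close>. If both
  boundaries ran through the arc in the same direction, one half would be mapped preserving the
  orientation and the other half reversing it; but the local degree of an injective continuous
  map on a convex set is constant (\<open>glued_annuli_not_both_positive\<close>).

  The number of faces is read off from homology: the face boundaries and the \<open>2 * g\<close> further
  loops form a basis of the first homology of the graph, which has rank \<open>ell\<close>, and the rank of a
  free Abelian group is unique (\<open>homology_basis_card\<close>).
\<close>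

section \<open>Local degrees of injective maps in the plane\<close>

text \<open>
  The disk \<open>cball z r\<close> can be moved to \<open>cball z' r'\<close> through disks in \<open>D\<close>, with linearly
  varying centre and radius, and injectivity keeps the image of each circle away from the image of
  its centre. So the local degree is the same at all points of \<open>D\<close>.
\<close>

lemma winding_number_injective_circlepath_eq:
  fixes h :: "complex \<Rightarrow> complex"
  assumes D: "convex D" and cont: "continuous_on D h" and inj: "inj_on h D"
    and r: "0 < r" "cball z r \<subseteq> D" and r': "0 < r'" "cball z' r' \<subseteq> D"
  shows "winding_number (h \<circ> circlepath z r) (h z) = winding_number (h \<circ> circlepath z' r') (h z')"
proof -
  define c where "c s = (1 - s) *\<^sub>R z + s *\<^sub>R z'" for s :: real
  define m where "m s = (1 - s) * r + s * r'" for s :: real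
  define H where "H = (\<lambda>(s, t). h (c s + of_real (m s) * exp (2 * of_real pi * \<i> * of_real t)) - h (c s))"
  have pt: "c s + of_real (m s) * u \<in> D" if s: "s \<in> {0..1}" and u: "cmod u \<le> 1" for s u
  proof -
    have "z + of_real r * u \<in> D" "z' + of_real r' * u \<in> D"
      using r r' u by (auto simp: dist_norm norm_mult subset_iff mult_left_le)
    then have "(1 - s) *\<^sub>R (z + of_real r * u) + s *\<^sub>R (z' + of_real r' * u) \<in> D"
      using D s by (auto intro: convexD)
    also have "(1 - s) *\<^sub>R (z + of_real r * u) + s *\<^sub>R (z' + of_real r' * u) = c s + of_real (m s) * u"
      by (simp add: c_def m_def scaleR_conv_of_real algebra_simps)
    finally show ?thesis .
  qed
  have cD: "c s \<in> D" if "s \<in> {0..1}" for s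
    using pt[OF that, of 0] by simp
  have mpos: "m s > 0" if "s \<in> {0..1}" for s
    using r(1) r'(1) that unfolding m_def
    by (cases "s = 0") (auto intro: add_nonneg_pos)
  have e1: "cmod (exp (2 * of_real pi * \<i> * of_real t)) \<le> 1" for t :: real
    by simp
  have "homotopic_loops (-{0}) (\<lambda>t. H (0, t)) (\<lambda>t. H (1, t))"
    unfolding homotopic_loops
  proof (intro exI conjI ballI)
    show "continuous_on ({0..1} \<times> {0..1}) H"
      unfolding H_def case_prod_unfold
      by (intro continuous_intros continuous_on_compose2[OF cont])
        (auto simp: c_def m_def intro!: continuous_intros cD[unfolded c_def]
           pt[unfolded c_def m_def of_real_add of_real_mult of_real_diff of_real_1])
    show "H \<in> {0..1} \<times> {0..1} \<rightarrow> - {0}"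
    proof clarsimp
      fix s t :: real assume st: "0 \<le> s" "s \<le> 1" and eq: "H (s, t) = 0"
      then have "c s + of_real (m s) * exp (2 * of_real pi * \<i> * of_real t) = c s"
        using inj_onD[OF inj, of "c s + of_real (m s) * exp (2 * of_real pi * \<i> * of_real t)" "c s"]
        by (simp add: H_def pt cD)
      then show False
        using mpos[of s] st by auto
    qed
    show "pathfinish (H \<circ> Pair t) = pathstart (H \<circ> Pair t)" if "t \<in> {0..1}" for t
      by (simp add: H_def pathfinish_def pathstart_def)
  qed auto
  then have "winding_number (\<lambda>t. H (0, t)) 0 = winding_number (\<lambda>t. H (1, t)) 0"
    by (rule winding_number_homotopic_loops)
  moreover have "(\<lambda>t. H (0, t)) = (\<lambda>t. (h \<circ> circlepath z r) t - h z)"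
    "(\<lambda>t. H (1, t)) = (\<lambda>t. (h \<circ> circlepath z' r') t - h z')"
    by (auto simp: H_def c_def m_def circlepath)
  ultimately show ?thesis
    using winding_number_offset[of "h \<circ> circlepath z r" "h z"]
      winding_number_offset[of "h \<circ> circlepath z' r'" "h z'"] by simp
qed

text \<open>
  Loops with the same winding number around \<open>z\<close> are homotopic in the plane without \<open>z\<close>;
  the homotopy can be pushed into the punctured disk, and there \<open>h\<close> maps it to a homotopy that
  avoids \<open>h z\<close>.
\<close>

lemma winding_number_injective_image_eq:
  fixes h :: "complex \<Rightarrow> complex"
  assumes \<rho>: "0 < \<rho>" and cont: "continuous_on (cball z \<rho>) h" and inj: "inj_on h (cball z \<rho>)"
    and p: "path p" "pathfinish p = pathstart p" "path_image p \<subseteq> cball z \<rho> - {z}"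
    and q: "path q" "pathfinish q = pathstart q" "path_image q \<subseteq> cball z \<rho> - {z}"
    and eq: "winding_number p z = winding_number q z"
  shows "winding_number (h \<circ> p) (h z) = winding_number (h \<circ> q) (h z)"
proof -
  \<comment> \<open>the radial retraction onto the disk, which moves no point to \<open>z\<close>\<close>
  define k where "k w = z + (w - z) /\<^sub>R max 1 (cmod (w - z) / \<rho>)" for w
  have contk: "continuous_on (-{z}) k"
    unfolding k_def by (intro continuous_intros) (use \<rho> in auto)
  have kball: "k w \<in> cball z \<rho> - {z}" if "w \<noteq> z" for w
  proof -
    have "cmod (w - z) / max 1 (cmod (w - z) / \<rho>) \<le> \<rho>"
      using \<rho> that by (auto simp: max_def field_simps)
    moreover have "k w \<noteq> z" using that by (auto simp: k_def max_def)
    ultimately show ?thesis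
      by (simp add: k_def dist_norm divide_inverse mult.commute max_def)
  qed
  have kid: "k w = w" if "w \<in> cball z \<rho>" for w
    using that \<rho> by (simp add: k_def dist_norm norm_minus_commute max_def)
  have "homotopic_loops (-{z}) p q"
    using winding_number_homotopic_loops_eq[of p z q] p q eq by auto
  then have "homotopic_loops (cball z \<rho> - {z}) (k \<circ> p) (k \<circ> q)"
    by (rule homotopic_loops_continuous_image) (use contk kball in auto)
  moreover have "homotopic_loops (cball z \<rho> - {z}) p (k \<circ> p)" "homotopic_loops (cball z \<rho> - {z}) q (k \<circ> q)"
    using p q kid by (intro homotopic_loops_eq; force simp: path_image_def)+
  ultimately have "homotopic_loops (cball z \<rho> - {z}) p q"
    using homotopic_loops_trans homotopic_loops_sym by blast
  then have "homotopic_loops (-{h z}) (h \<circ> p) (h \<circ> q)"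
  proof (rule homotopic_loops_continuous_image)
    show "continuous_on (cball z \<rho> - {z}) h"
      using cont by (rule continuous_on_subset) auto
    show "h \<in> cball z \<rho> - {z} \<rightarrow> - {h z}"
      using inj_onD[OF inj, of _ z] \<rho> by auto
  qed
  then show ?thesis
    by (rule winding_number_homotopic_loops)
qed

text \<open>
  The hypothesis on \<open>h\<close> speaks of round circles only; this is its consequence for any loop that
  winds once around \<open>z\<close>, in either sense. It serves as the multiplicativity of the local degree.
\<close>

lemma winding_number_orientation_preserving:
  assumes h: "orientation_preserving D h" "continuous_on D h" "inj_on h D"
    and \<rho>: "0 < \<rho>" "cball z \<rho> \<subseteq> D"
    and p: "path p" "pathfinish p = pathstart p" "path_image p \<subseteq> cball z \<rho> - {z}"
    and wn: "winding_number p z = 1 \<or> winding_number p z = -1"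
  shows "winding_number (h \<circ> p) (h z) = winding_number p z"
proof -
  have cont: "continuous_on (cball z \<rho>) h" and inj: "inj_on h (cball z \<rho>)"
    using h \<rho> by (auto intro: continuous_on_subset inj_on_subset)
  let ?C = "circlepath z \<rho>"
  have C: "path ?C" "pathfinish ?C = pathstart ?C" "path_image ?C \<subseteq> cball z \<rho> - {z}"
    "winding_number ?C z = 1"
    using \<rho> by (auto simp: winding_number_circlepath_centre dist_norm norm_minus_commute)
  have hC: "winding_number (h \<circ> ?C) (h z) = 1"
    using h(1) \<rho> unfolding orientation_preserving_def by blast
  from wn show ?thesis
  proof
    assume 1: "winding_number p z = 1"
    then show ?thesis
      using winding_number_injective_image_eq[OF \<rho>(1) cont inj p C(1-3)] C(4) hC by simp
  next
    assume 1: "winding_number p z = -1"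
    let ?R = "reversepath ?C"
    have "winding_number ?R z = -1"
      using C by (subst winding_number_reversepath) auto
    then have "winding_number (h \<circ> p) (h z) = winding_number (h \<circ> ?R) (h z)"
      using C 1 by (intro winding_number_injective_image_eq[OF \<rho>(1) cont inj p]) auto
    also have "h \<circ> ?R = reversepath (h \<circ> ?C)"
      by (auto simp: reversepath_def)
    also have "winding_number \<dots> (h z) = - winding_number (h \<circ> ?C) (h z)"
    proof (rule winding_number_reversepath)
      show "path (h \<circ> ?C)"
        using C(1,3) cont by (intro path_continuous_image) (auto intro: continuous_on_subset)
      show "h z \<notin> path_image (h \<circ> ?C)"
        using C(3) inj_onD[OF inj, of z] \<rho>(1) by (force simp: path_image_compose)
    qed
    finally show ?thesis unfolding hC 1 .
  qed
qed

lemma winding_number_cmult: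
  assumes c: "c \<noteq> 0" and p: "path p" "pathfinish p = pathstart p" "0 \<notin> path_image p"
  shows "winding_number (\<lambda>t. c * p t) 0 = winding_number p 0"
proof -
  \<comment> \<open>a path from \<open>1\<close> to \<open>c\<close> through nonzero numbers\<close>
  define H where "H = (\<lambda>(s::real, t). exp (of_real s * Ln c) * p t)"
  have "homotopic_loops (-{0}) p (\<lambda>t. c * p t)"
    unfolding homotopic_loops
  proof (rule exI[of _ H], intro conjI ballI)
    show "continuous_on ({0..1} \<times> {0..1}) H"
      unfolding H_def case_prod_unfold using p(1)
      by (auto simp: path_def intro!: continuous_intros continuous_on_compose2[of "{0..1}" p])
    show "H \<in> {0..1} \<times> {0..1} \<rightarrow> - {0}"
      using p(3) by (auto simp: H_def path_image_def)
    show "pathfinish (H \<circ> Pair t) = pathstart (H \<circ> Pair t)" if "t \<in> {0..1}" for t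
      using p(2) by (simp add: H_def pathfinish_def pathstart_def)
  qed (use c in \<open>auto simp: H_def\<close>)
  then show ?thesis
    by (rule winding_number_homotopic_loops[symmetric])
qed

text \<open>
  This bound makes \<open>exp u - 1\<close> homotopic to \<open>u\<close> along a straight segment that avoids
  \<open>0\<close>.
\<close>

lemma norm_exp_minus_one_minus_id_less:
  fixes u :: complex
  assumes "u \<noteq> 0" "cmod u \<le> 1/4"
  shows "cmod (exp u - 1 - u) < cmod u"
proof -
  have "cmod (exp u - (\<Sum>i\<le>1. u ^ i / fact i)) \<le> exp \<bar>Re u\<bar> * (cmod u ^ Suc 1) / fact 1"
    by (rule Taylor_exp)
  then have 1: "cmod (exp u - 1 - u) \<le> exp \<bar>Re u\<bar> * (cmod u ^ 2)"
    by (simp add: numeral_2_eq_2 diff_diff_eq)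
  have "\<bar>Re u\<bar> \<le> 1" using abs_Re_le_cmod[of u] assms(2) by linarith
  then have "exp \<bar>Re u\<bar> \<le> exp 1" by simp
  also have "exp (1::real) < 3" using e_less_272 by simp
  finally have e: "exp \<bar>Re u\<bar> < 3" .
  have "exp \<bar>Re u\<bar> * (cmod u ^ 2) \<le> 3 * (cmod u * (1/4))"
    unfolding power2_eq_square using assms e by (intro mult_mono) auto
  also have "\<dots> < cmod u" using assms by simp
  finally show ?thesis using 1 by simp
qed

text \<open>
  In polar coordinates the point with angle \<open>\<theta> (Re w)\<close> and radius \<open>exp (- \<sigma> * Im w)\<close>.
  The real line goes to an arc of the unit circle parametrised by \<open>\<theta>\<close>; the inside of the circle
  corresponds to the upper half plane for \<open>\<sigma> = 1\<close> and to the lower one for \<open>\<sigma> = -1\<close>.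
\<close>

definition annulus_map :: "(real \<Rightarrow> real) \<Rightarrow> real \<Rightarrow> complex \<Rightarrow> complex" where
  "annulus_map \<theta> \<sigma> w = exp (\<i> * Complex (\<theta> (Re w)) (\<sigma> * Im w))"

text \<open>
  For increasing \<open>\<theta>\<close> and \<open>\<sigma> = 1\<close> the local degree is \<open>1\<close>. The map is \<open>exp (\<i> * T z)\<close>
  with \<open>T z = \<theta> (Re z) + \<i> * Im z\<close>. Both \<open>T z - T w\<close> and \<open>z - w\<close> have the same imaginary part,
  and real parts of the same sign, so that the segment between them avoids \<open>0\<close>; near \<open>T w\<close> the
  exponential map is homotopic to its linear part.
\<close>

lemma winding_number_annulus_map_pos:
  assumes \<theta>: "continuous_on I \<theta>" "strict_mono_on I \<theta>"
    and r: "0 < r" "\<And>z. z \<in> cball w r \<Longrightarrow> Re z \<in> I"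
    and small: "\<And>z. z \<in> cball w r \<Longrightarrow>
      cmod (Complex (\<theta> (Re z)) (Im z) - Complex (\<theta> (Re w)) (Im w)) \<le> 1/4"
  shows "winding_number (annulus_map \<theta> 1 \<circ> circlepath w r) (annulus_map \<theta> 1 w) = 1"
    and "annulus_map \<theta> 1 w \<notin> path_image (annulus_map \<theta> 1 \<circ> circlepath w r)"
proof -
  let ?C = "circlepath w r"
  define T where "T z = Complex (\<theta> (Re z)) (Im z)" for z
  define g0 where "g0 t = ?C t - w" for t
  define g1 where "g1 t = T (?C t) - T w" for t
  have inC: "?C t \<in> cball w r" if "t \<in> {0..1}" for t
    using r(1) by (simp add: circlepath dist_norm norm_mult)
  have ne: "?C t \<noteq> w" for t
    using r(1) by (simp add: circlepath)
  have contT: "continuous_on (cball w r) T"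
    unfolding T_def Complex_eq
    by (intro continuous_intros continuous_on_compose2[OF \<theta>(1)]) (use r in auto)
  have pathC: "path ?C" by simp
  have pT: "path (T \<circ> ?C)"
    using contT inC by (intro path_continuous_image) (auto simp: path_image_def intro: continuous_on_subset)
  have p1: "path g1"
    using pT unfolding g1_def path_def o_def by (intro continuous_intros) auto
  have p0: "path g0"
    using pathC unfolding g0_def path_def by (intro continuous_intros) auto
  have l0: "pathfinish g0 = pathstart g0" and l1: "pathfinish g1 = pathstart g1"
    by (simp_all add: g0_def g1_def pathfinish_def pathstart_def circlepath)
  have Re_sgn: "sgn (Re (g1 t)) = sgn (Re (g0 t))" and Im_eq: "Im (g1 t) = Im (g0 t)"
    if t: "t \<in> {0..1}" for t
  proof -
    have I: "Re (?C t) \<in> I" "Re w \<in> I"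
      using r inC[OF t] by auto
    show "sgn (Re (g1 t)) = sgn (Re (g0 t))"
      using strict_mono_onD[OF \<theta>(2) I] strict_mono_onD[OF \<theta>(2) I(2,1)]
      by (cases "Re (?C t)" "Re w" rule: linorder_cases) (auto simp: g0_def g1_def T_def)
    show "Im (g1 t) = Im (g0 t)" by (simp add: g0_def g1_def T_def)
  qed
  have g0nz: "g0 t \<noteq> 0" for t using ne by (simp add: g0_def)
  have g1nz: "g1 t \<noteq> 0" if t: "t \<in> {0..1}" for t
    using Re_sgn[OF t] Im_eq[OF t] g0nz[of t] by (auto simp: complex_eq_iff sgn_eq_0_iff)
  have w0: "winding_number g0 0 = 1"
    using winding_number_offset[of ?C w] winding_number_circlepath_centre[OF r(1), of w]
    by (simp add: g0_def[abs_def])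
  have "winding_number g1 0 = winding_number g0 0"
  proof (rule winding_number_loops_linear_eq[OF p0 p1 l0 l1])
    fix t :: real assume t: "t \<in> {0..1}"
    show "0 \<notin> closed_segment (g0 t) (g1 t)"
    proof
      assume "0 \<in> closed_segment (g0 t) (g1 t)"
      then obtain u where u: "0 \<le> u" "u \<le> 1" "0 = (1 - u) *\<^sub>R g0 t + u *\<^sub>R g1 t"
        by (auto simp: closed_segment_def)
      then have R: "(1 - u) * Re (g0 t) + u * Re (g1 t) = 0" and I: "(1 - u) * Im (g0 t) + u * Im (g1 t) = 0"
        by (auto simp: complex_eq_iff)
      have I0: "Im (g0 t) = 0" using I Im_eq[OF t] by (simp add: algebra_simps)
      then have R0: "Re (g0 t) \<noteq> 0" using g0nz[of t] by (auto simp: complex_eq_iff)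
      show False
      proof (cases "Re (g0 t) > 0")
        case True
        then have "Re (g1 t) > 0" using Re_sgn[OF t] by (auto simp: sgn_if split: if_splits)
        then have "(1 - u) * Re (g0 t) + u * Re (g1 t) > 0" using True u
          by (cases "u = 0") (auto intro: add_nonneg_pos)
        then show False using R by simp
      next
        case False
        then have neg: "Re (g0 t) < 0" using R0 by simp
        then have "Re (g1 t) < 0" using Re_sgn[OF t] by (auto simp: sgn_if split: if_splits)
        then have "(1 - u) * Re (g0 t) + u * Re (g1 t) < 0" using neg u
          by (cases "u = 0") (auto intro!: add_nonpos_neg mult_pos_neg mult_nonneg_nonpos)
        then show False using R by simp
      qed
    qed
  qed
  with w0 have w1: "winding_number g1 0 = 1" by simp
  \<comment> \<open>the derivative of \<open>\<lambda>v. exp (\<i> * v)\<close> at \<open>T w\<close>\<close>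
  define c where "c = \<i> * exp (\<i> * T w)"
  have c: "c \<noteq> 0" by (simp add: c_def)
  define g2 where "g2 t = c * g1 t" for t
  define g3 where "g3 t = annulus_map \<theta> 1 (?C t) - annulus_map \<theta> 1 w" for t
  have w2: "winding_number g2 0 = 1"
    unfolding g2_def using winding_number_cmult[OF c p1 l1] g1nz w1 by (force simp: path_image_def)
  have am: "annulus_map \<theta> 1 z = exp (\<i> * T z)" for z by (simp add: annulus_map_def T_def)
  have g3: "g3 t = exp (\<i> * T w) * (exp (\<i> * g1 t) - 1)" for t
    by (simp add: g3_def g1_def am exp_diff right_diff_distrib)
  have g2: "g2 t = exp (\<i> * T w) * (\<i> * g1 t)" for t by (simp add: g2_def c_def)
  have near: "cmod (exp (\<i> * g1 t) - 1 - \<i> * g1 t) < cmod (\<i> * g1 t)" if t: "t \<in> {0..1}" for t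
    using norm_exp_minus_one_minus_id_less[of "\<i> * g1 t"] g1nz[OF t] small[OF inC[OF t]]
    by (simp add: norm_mult g1_def T_def)
  have "winding_number g3 0 = winding_number g2 0"
  proof (rule winding_number_nearby_loops_eq)
    show "path g2" "path g3"
      using p1 unfolding g2_def g3 path_def by (intro continuous_intros; simp)+
    show "pathfinish g2 = pathstart g2" "pathfinish g3 = pathstart g3"
      using l1 unfolding g2_def g3 pathfinish_def pathstart_def by simp_all
    fix t :: real assume t: "t \<in> {0..1}"
    have "g3 t - g2 t = exp (\<i> * T w) * (exp (\<i> * g1 t) - 1 - \<i> * g1 t)"
      by (simp add: g3 g2 algebra_simps)
    then show "cmod (g3 t - g2 t) < cmod (g2 t - 0)"
      using near[OF t] by (simp only: g2 norm_mult diff_0_right) (simp add: norm_mult)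
  qed
  then show "winding_number (annulus_map \<theta> 1 \<circ> ?C) (annulus_map \<theta> 1 w) = 1"
    using winding_number_offset[of "annulus_map \<theta> 1 \<circ> ?C" "annulus_map \<theta> 1 w"] w2
    by (simp add: g3_def[abs_def])
  have "g3 t \<noteq> 0" if t: "t \<in> {0..1}" for t
    using near[OF t] by (auto simp: g3)
  then show "annulus_map \<theta> 1 w \<notin> path_image (annulus_map \<theta> 1 \<circ> ?C)"
    by (force simp: path_image_def g3_def)
qed

lemma annulus_map_neg: "annulus_map \<theta> (-1) w = annulus_map \<theta> 1 (cnj w)"
  by (simp add: annulus_map_def)

lemma continuous_on_annulus_map:
  assumes "continuous_on I \<theta>" "\<And>z. z \<in> V \<Longrightarrow> Re z \<in> I"
  shows "continuous_on V (annulus_map \<theta> \<sigma>)"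
  unfolding annulus_map_def Complex_eq
  by (intro continuous_intros continuous_on_compose2[OF assms(1)]) (use assms(2) in auto)

text \<open>
  The case \<open>\<sigma> = -1\<close> is obtained from \<open>\<sigma> = 1\<close> by complex conjugation of the argument, which
  reverses circles.
\<close>

lemma winding_number_annulus_map:
  assumes \<theta>: "continuous_on I \<theta>" "strict_mono_on I \<theta>"
    and V: "open V" "w \<in> V" "\<And>z. z \<in> V \<Longrightarrow> Re z \<in> I"
    and \<sigma>: "\<sigma> = 1 \<or> \<sigma> = -1"
  obtains r0 where "0 < r0"
    "\<And>r. 0 < r \<Longrightarrow> r \<le> r0 \<Longrightarrow> cball w r \<subseteq> V \<and>
       winding_number (annulus_map \<theta> \<sigma> \<circ> circlepath w r) (annulus_map \<theta> \<sigma> w) = of_real \<sigma> \<and>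
       annulus_map \<theta> \<sigma> w \<notin> path_image (annulus_map \<theta> \<sigma> \<circ> circlepath w r)"
proof -
  define T where "T z = Complex (\<theta> (Re z)) (\<sigma> * Im z)" for z
  have contT: "continuous_on V T"
    unfolding T_def Complex_eq
    by (intro continuous_intros continuous_on_compose2[OF \<theta>(1)]) (use V in auto)
  then have "isCont T w" using V continuous_on_eq_continuous_at by blast
  then obtain d where d: "d > 0" "\<And>z. dist z w < d \<Longrightarrow> dist (T z) (T w) < 1/4"
    unfolding continuous_at_eps_delta by (elim allE[of _ "1/4"]) auto
  obtain e where e: "e > 0" "cball w e \<subseteq> V"
    using V open_contains_cball by blast
  show ?thesis
  proof (rule that[of "min e (d/2)"])
    show "0 < min e (d/2)" using d e by auto
    fix r :: real assume r: "0 < r" "r \<le> min e (d/2)"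
    then have sub: "cball w r \<subseteq> V" using e subset_cball[of r e w] by auto
    have small: "cmod (T z - T w) \<le> 1/4" if "z \<in> cball w r" for z
      using d(2)[of z] that r d(1) by (auto simp: dist_norm norm_minus_commute)
    have "winding_number (annulus_map \<theta> \<sigma> \<circ> circlepath w r) (annulus_map \<theta> \<sigma> w) = of_real \<sigma> \<and>
       annulus_map \<theta> \<sigma> w \<notin> path_image (annulus_map \<theta> \<sigma> \<circ> circlepath w r)"
      using \<sigma>
    proof
      assume [simp]: "\<sigma> = 1"
      show ?thesis
        using winding_number_annulus_map_pos[OF \<theta> r(1), of w] V(3)[OF subsetD[OF sub]] small
        by (simp add: T_def)
    next
      assume [simp]: "\<sigma> = -1"
      have cb: "z \<in> cball (cnj w) r \<longleftrightarrow> cnj z \<in> cball w r" for z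
        unfolding mem_cball dist_norm by (metis complex_cnj_cnj complex_cnj_diff complex_mod_cnj)
      let ?q = "annulus_map \<theta> 1 \<circ> circlepath (cnj w) r"
      have I': "Re z \<in> I"
        and small': "cmod (Complex (\<theta> (Re z)) (Im z) - Complex (\<theta> (Re (cnj w))) (Im (cnj w))) \<le> 1 / 4"
        if "z \<in> cball (cnj w) r" for z
      proof -
        have z: "cnj z \<in> cball w r" using that by (simp only: cb)
        show "Re z \<in> I" using sub V(3)[of "cnj z"] z by auto
        show "cmod (Complex (\<theta> (Re z)) (Im z) - Complex (\<theta> (Re (cnj w))) (Im (cnj w))) \<le> 1 / 4"
          using small[OF z] by (simp add: T_def)
      qed
      have 1: "winding_number ?q (annulus_map \<theta> 1 (cnj w)) = 1"
        "annulus_map \<theta> 1 (cnj w) \<notin> path_image ?q"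
        using winding_number_annulus_map_pos[OF \<theta> r(1) I' small'] by blast+
      \<comment> \<open>conjugation turns the circle into a circle that is traversed backwards\<close>
      have "cnj (circlepath w r t) = circlepath (cnj w) r (1 - t)" for t
        by (simp add: circlepath exp_cnj right_diff_distrib exp_diff exp_minus inverse_eq_divide)
      then have eq: "annulus_map \<theta> \<sigma> \<circ> circlepath w r = reversepath ?q"
        by (auto simp: reversepath_def annulus_map_neg)
      have pq: "path ?q"
      proof (rule path_continuous_image)
        show "continuous_on (path_image (circlepath (cnj w) r)) (annulus_map \<theta> 1)"
        proof (rule continuous_on_annulus_map[OF \<theta>(1)])
          fix z assume "z \<in> path_image (circlepath (cnj w) r)"
          then have "z \<in> cball (cnj w) r" using r(1) by auto
          then have "cnj z \<in> V" using sub unfolding cb by auto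
          then show "Re z \<in> I" using V(3)[of "cnj z"] by auto
        qed
      qed simp
      show ?thesis
        using 1 unfolding eq by (simp add: winding_number_reversepath[OF pq] annulus_map_neg)
    qed
    with sub show "cball w r \<subseteq> V \<and>
       winding_number (annulus_map \<theta> \<sigma> \<circ> circlepath w r) (annulus_map \<theta> \<sigma> w) = of_real \<sigma> \<and>
       annulus_map \<theta> \<sigma> w \<notin> path_image (annulus_map \<theta> \<sigma> \<circ> circlepath w r)" by blast
  qed
qed

lemma winding_number_annulus_chart:
  assumes \<theta>: "continuous_on I \<theta>" "strict_mono_on I \<theta>"
    and V: "open V" "w \<in> V" "\<And>z. z \<in> V \<Longrightarrow> Re z \<in> I"
    and \<sigma>: "\<sigma> = 1 \<or> \<sigma> = -1"
    and D: "open D" "orientation_preserving D f" "continuous_on D f" "inj_on f D"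
    and H: "\<And>z. z \<in> V \<Longrightarrow> annulus_map \<theta> \<sigma> z \<in> D \<and> H z = f (annulus_map \<theta> \<sigma> z)"
  obtains r where "0 < r" "cball w r \<subseteq> V"
    "winding_number (H \<circ> circlepath w r) (H w) = of_real \<sigma>"
proof -
  let ?P = "annulus_map \<theta> \<sigma>"
  have contP: "continuous_on V ?P"
    using continuous_on_annulus_map[OF \<theta>(1)] V(3) by blast
  obtain r0 where r0: "0 < r0"
    "\<And>r. 0 < r \<Longrightarrow> r \<le> r0 \<Longrightarrow> cball w r \<subseteq> V \<and>
       winding_number (?P \<circ> circlepath w r) (?P w) = of_real \<sigma> \<and>
       ?P w \<notin> path_image (?P \<circ> circlepath w r)"
    using winding_number_annulus_map[OF \<theta> V \<sigma>] by metis
  obtain \<rho> where \<rho>: "\<rho> > 0" "cball (?P w) \<rho> \<subseteq> D"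
    using D(1) H[OF V(2)] open_contains_cball by blast
  have "isCont ?P w" using contP V continuous_on_eq_continuous_at by blast
  then obtain d where d: "d > 0" "\<And>z. dist z w < d \<Longrightarrow> dist (?P z) (?P w) < \<rho>"
    unfolding continuous_at_eps_delta using \<rho> by metis
  define r where "r = min r0 (d/2)"
  have r: "0 < r" "r \<le> r0" "r < d" using r0 d by (auto simp: r_def)
  note R = r0(2)[OF r(1,2)]
  have pim: "path_image (circlepath w r) \<subseteq> cball w r" using r(1) by auto
  let ?p = "?P \<circ> circlepath w r"
  have "path ?p"
    using R pim contP by (intro path_continuous_image) (auto intro: continuous_on_subset)
  moreover have "pathfinish ?p = pathstart ?p"
    by (simp add: pathfinish_compose pathstart_compose)
  moreover have "path_image ?p \<subseteq> cball (?P w) \<rho> - {?P w}"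
  proof -
    have "?P z \<in> cball (?P w) \<rho>" if "z \<in> path_image (circlepath w r)" for z
      using d(2)[of z] pim that r by (auto simp: dist_commute intro: less_imp_le)
    then show ?thesis using R unfolding path_image_compose by blast
  qed
  ultimately have "winding_number (f \<circ> ?p) (f (?P w)) = winding_number ?p (?P w)"
    using R \<sigma> by (intro winding_number_orientation_preserving[OF D(2-4) \<rho>]) auto
  also have "winding_number (f \<circ> ?p) (f (?P w)) = winding_number (H \<circ> circlepath w r) (H w)"
  proof -
    have "f (?P w) = H w" using H V by simp
    moreover have "winding_number (f \<circ> ?p) z = winding_number (H \<circ> circlepath w r) z" for z
    proof (rule winding_number_cong)
      fix t :: real assume "0 \<le> t" "t \<le> 1"
      then have "circlepath w r t \<in> path_image (circlepath w r)" by (auto simp: path_image_def)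
      then have "circlepath w r t \<in> V" using pim R by blast
      then show "(f \<circ> ?p) t = (H \<circ> circlepath w r) t" using H by simp
    qed
    ultimately show ?thesis by simp
  qed
  finally show ?thesis using that[OF r(1)] R by metis
qed

text \<open>
  On the upper half of \<open>B\<close> the map \<open>H\<close> has local degree \<open>1\<close>, on the lower half it
  has local degree \<open>-1\<close>, which is impossible for an injective map on a convex set.
\<close>

lemma glued_annuli_not_both_positive:
  assumes B: "open B" "convex B" "of_real s0 \<in> B" "\<And>z. z \<in> B \<Longrightarrow> Re z \<in> I"
    and H: "continuous_on B H" "inj_on H B"
    and \<theta>1: "continuous_on I \<theta>1" "strict_mono_on I \<theta>1"
    and \<theta>2: "continuous_on I \<theta>2" "strict_mono_on I \<theta>2"
    and D1: "open D1" "orientation_preserving D1 f1" "continuous_on D1 f1" "inj_on f1 D1"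
    and D2: "open D2" "orientation_preserving D2 f2" "continuous_on D2 f2" "inj_on f2 D2"
    and H1: "\<And>z. z \<in> B \<Longrightarrow> Im z > 0 \<Longrightarrow> annulus_map \<theta>1 1 z \<in> D1 \<and> H z = f1 (annulus_map \<theta>1 1 z)"
    and H2: "\<And>z. z \<in> B \<Longrightarrow> Im z < 0 \<Longrightarrow> annulus_map \<theta>2 (-1) z \<in> D2 \<and> H z = f2 (annulus_map \<theta>2 (-1) z)"
  shows False
proof -
  obtain R where R: "R > 0" "cball (of_real s0) R \<subseteq> B"
    using B open_contains_cball by blast
  let ?V1 = "B \<inter> {z. Im z > 0}" and ?V2 = "B \<inter> {z. Im z < 0}"
  have V: "open ?V1" "open ?V2"
    using B by (auto intro: open_halfspace_Im_gt open_halfspace_Im_lt)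
  have "Complex s0 R \<in> cball (of_real s0) R" "Complex s0 (-R) \<in> cball (of_real s0) R"
    using R by (auto simp: dist_norm complex_of_real_def complex_diff complex_norm)
  then have w: "Complex s0 R \<in> ?V1" "Complex s0 (-R) \<in> ?V2" using R by auto
  obtain r1 where r1: "0 < r1" "cball (Complex s0 R) r1 \<subseteq> ?V1"
    "winding_number (H \<circ> circlepath (Complex s0 R) r1) (H (Complex s0 R)) = of_real 1"
    using winding_number_annulus_chart[OF \<theta>1 V(1) w(1) _ _ D1, of 1 H] H1 B(4) by auto
  obtain r2 where r2: "0 < r2" "cball (Complex s0 (-R)) r2 \<subseteq> ?V2"
    "winding_number (H \<circ> circlepath (Complex s0 (-R)) r2) (H (Complex s0 (-R))) = of_real (-1)"
    using winding_number_annulus_chart[OF \<theta>2 V(2) w(2) _ _ D2, of "-1" H] H2 B(4) by auto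
  have "winding_number (H \<circ> circlepath (Complex s0 R) r1) (H (Complex s0 R))
      = winding_number (H \<circ> circlepath (Complex s0 (-R)) r2) (H (Complex s0 (-R)))"
    by (rule winding_number_injective_circlepath_eq[OF B(2) H r1(1) _ r2(1)]) (use r1 r2 in auto)
  with r1 r2 show False by simp
qed

section \<open>Surfaces, and disks glued along an arc\<close>

lemma chart_embedding:
  assumes "chart S U c"
  shows "continuous_map (subtopology S U) euclidean c" "inj_on c U" "openin S U" "U \<subseteq> topspace S"
    and "\<And>W. openin S W \<Longrightarrow> W \<subseteq> U \<Longrightarrow> open (c ` W)"
    and "\<And>V. open V \<Longrightarrow> V \<subseteq> c ` U \<Longrightarrow> openin S {x \<in> U. c x \<in> V}"
    and "continuous_map (top_of_set (c ` U)) (subtopology S U) (inv_into U c)"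
proof -
  have U: "openin S U" and cU: "open (c ` U)"
    and hm: "homeomorphic_map (subtopology S U) (top_of_set (c ` U)) c"
    using assms by (auto simp: chart_def)
  show US: "U \<subseteq> topspace S" using U by (rule openin_subset)
  show "openin S U" by (rule U)
  have ts: "topspace (subtopology S U) = U" using US by auto
  show inj: "inj_on c U" using hm ts by (metis homeomorphic_imp_injective_map)
  have cm: "continuous_map (subtopology S U) (top_of_set (c ` U)) c"
    using hm by (rule homeomorphic_imp_continuous_map)
  then show "continuous_map (subtopology S U) euclidean c"
    by (simp add: continuous_map_in_subtopology)
  show "open (c ` W)" if "openin S W" "W \<subseteq> U" for W
  proof -
    have "openin (subtopology S U) W" using that by (metis openin_subset_topspace_eq openin_subtopology inf.absorb1)
    then have "openin (top_of_set (c ` U)) (c ` W)"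
      using homeomorphic_imp_open_map[OF hm] by (auto simp: open_map_def)
    then show ?thesis using cU by (simp add: openin_open_eq)
  qed
  show "openin S {x \<in> U. c x \<in> V}" if "open V" "V \<subseteq> c ` U" for V
  proof -
    have "openin (top_of_set (c ` U)) V" using that cU by (simp add: openin_open_eq)
    then have "openin (subtopology S U) {x \<in> topspace (subtopology S U). c x \<in> V}"
      using cm openin_continuous_map_preimage by blast
    moreover have "{x \<in> topspace (subtopology S U). c x \<in> V} = {x \<in> U. c x \<in> V}" using ts by auto
    ultimately show ?thesis using U by (simp add: openin_open_subtopology)
  qed
  show "continuous_map (top_of_set (c ` U)) (subtopology S U) (inv_into U c)"
  proof -
    obtain g where g: "homeomorphic_maps (subtopology S U) (top_of_set (c ` U)) c g"
      using hm homeomorphic_map_maps by blast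
    show ?thesis
    proof (rule continuous_map_eq[of _ _ g])
      show "continuous_map (top_of_set (c ` U)) (subtopology S U) g"
        using g by (simp add: homeomorphic_maps_def)
      show "g x = inv_into U c x" if "x \<in> topspace (top_of_set (c ` U))" for x
        using g that ts inj by (auto simp: homeomorphic_maps_def inv_into_f_f)
    qed
  qed
qed

lemma oriented_surface_chart_at:
  assumes "oriented_surface S A" "p \<in> topspace S"
  obtains U c where "(U, c) \<in> A" "chart S U c" "p \<in> U"
proof -
  have "p \<in> (\<Union>(U, c) \<in> A. U)" using assms by (simp add: oriented_surface_def)
  then obtain U c where "(U, c) \<in> A" "p \<in> U" by auto
  moreover from this have "chart S U c" using assms(1) by (auto simp: oriented_surface_def)
  ultimately show ?thesis using that by blast
qed

lemma continuous_map_preimage_open: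
  fixes \<psi> :: "complex \<Rightarrow> 'a"
  assumes "continuous_map (top_of_set Y) S \<psi>" "open Y" "openin S W"
  shows "open {y \<in> Y. \<psi> y \<in> W}"
  using openin_continuous_map_preimage[OF assms(1,3)] assms(2) by (simp add: openin_open_eq)

lemma chart_compose:
  fixes \<psi> :: "complex \<Rightarrow> 'a"
  assumes c: "chart S U c" and \<psi>: "continuous_map (top_of_set Y) S \<psi>"
    and Z: "Z \<subseteq> Y" "\<psi> ` Z \<subseteq> U"
  shows "continuous_on Z (c \<circ> \<psi>)" and "inj_on \<psi> Y \<Longrightarrow> inj_on (c \<circ> \<psi>) Z"
proof -
  have "continuous_map (top_of_set Z) S \<psi>"
    using \<psi> Z(1) by (metis continuous_map_from_subtopology_mono)
  then have "continuous_map (top_of_set Z) (subtopology S U) \<psi>"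
    using Z(2) by (simp add: continuous_map_in_subtopology image_subset_iff_funcset)
  then have "continuous_map (top_of_set Z) euclidean (c \<circ> \<psi>)"
    using chart_embedding(1)[OF c] by (rule continuous_map_compose)
  then show "continuous_on Z (c \<circ> \<psi>)" by simp
  show "inj_on (c \<circ> \<psi>) Z" if "inj_on \<psi> Y"
    using chart_embedding(2)[OF c] that Z by (intro comp_inj_on) (auto intro: inj_on_subset)
qed

text \<open>
  Invariance of domain in the plane, applied to the composition of \<open>\<psi>\<close> with charts.
\<close>

lemma surface_invariance_of_domain:
  fixes \<psi> :: "complex \<Rightarrow> 'a"
  assumes S: "oriented_surface S A" and Y: "open Y"
    and \<psi>: "continuous_map (top_of_set Y) S \<psi>" "inj_on \<psi> Y"
  shows "openin S (\<psi> ` Y)"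
proof (subst openin_subopen, intro ballI)
  fix p assume "p \<in> \<psi> ` Y"
  then obtain y where y: "y \<in> Y" "p = \<psi> y" by auto
  then have "p \<in> topspace S" using \<psi>(1) by (auto simp: continuous_map_def)
  then obtain U c where c: "chart S U c" "p \<in> U"
    using S oriented_surface_chart_at by metis
  let ?Y' = "{y \<in> Y. \<psi> y \<in> U}"
  have Y': "open ?Y'" using continuous_map_preimage_open[OF \<psi>(1) Y chart_embedding(3)[OF c(1)]] .
  have sub: "?Y' \<subseteq> Y" "\<psi> ` ?Y' \<subseteq> U" by auto
  have "continuous_on ?Y' (c \<circ> \<psi>)" "inj_on (c \<circ> \<psi>) ?Y'"
    using chart_compose[OF c(1) \<psi>(1) sub] \<psi>(2) by auto
  then have "open ((c \<circ> \<psi>) ` ?Y')" using Y' invariance_of_domain by blast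
  then have "openin S {x \<in> U. c x \<in> (c \<circ> \<psi>) ` ?Y'}"
    by (rule chart_embedding(6)[OF c(1)]) auto
  moreover have "{x \<in> U. c x \<in> (c \<circ> \<psi>) ` ?Y'} \<subseteq> \<psi> ` Y"
    using inj_onD[OF chart_embedding(2)[OF c(1)]] by fastforce
  moreover have "p \<in> {x \<in> U. c x \<in> (c \<circ> \<psi>) ` ?Y'}"
    using y c by auto
  ultimately show "\<exists>T. openin S T \<and> p \<in> T \<and> T \<subseteq> \<psi> ` Y" by blast
qed

text \<open>
  If an embedded copy of a plane set \<open>Y\<close> is a neighbourhood of the image of \<open>z\<close> in the surface,
  then the inverse of the embedding, read in a chart, is an injective map from an open set of the
  plane into \<open>Y\<close>, and its image is open by invariance of domain.
\<close>

lemma surface_neighbourhood_interior: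
  fixes m :: "complex \<Rightarrow> 'a"
  assumes S: "oriented_surface S A" and m: "embedding_map (top_of_set Y) S m"
    and W: "openin S W" "W \<subseteq> m ` Y" and z: "z \<in> Y" "m z \<in> W"
  shows "z \<in> interior Y"
proof -
  obtain k where k: "homeomorphic_maps (top_of_set Y) (subtopology S (m ` Y)) m k"
    using m unfolding embedding_map_def by (metis homeomorphic_map_maps topspace_euclidean_subtopology)
  then have ck: "continuous_map (subtopology S (m ` Y)) (top_of_set Y) k"
    and km: "\<And>y. y \<in> Y \<Longrightarrow> k (m y) = y"
    by (auto simp: homeomorphic_maps_def)
  obtain U c where c: "chart S U c" "m z \<in> U"
    using S oriented_surface_chart_at z W(1) openin_subset by (metis subsetD)
  note ce = chart_embedding[OF c(1)]
  define W' where "W' = W \<inter> U"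
  have W': "openin S W'" "W' \<subseteq> U" "W' \<subseteq> m ` Y" "m z \<in> W'"
    using W z c ce by (auto simp: W'_def)
  have V: "open (c ` W')" by (rule ce(5)[OF W'(1,2)])
  let ?j = "inv_into U c"
  have jc: "?j (c x) = x" if "x \<in> W'" for x using that W' ce(2) by (simp add: inv_into_f_f subset_iff)
  have "continuous_map (top_of_set (c ` U)) S ?j"
    using ce(7) by (rule continuous_map_into_fulltopology)
  then have "continuous_map (top_of_set (c ` W')) S ?j"
    using W'(2) by (elim continuous_map_from_subtopology_mono) auto
  then have "continuous_map (top_of_set (c ` W')) (subtopology S (m ` Y)) ?j"
    using jc W'(3) by (auto simp: continuous_map_in_subtopology)
  then have "continuous_map (top_of_set (c ` W')) (top_of_set Y) (k \<circ> ?j)"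
    using ck by (rule continuous_map_compose)
  then have cont: "continuous_on (c ` W') (k \<circ> ?j)"
    by (simp add: continuous_map_in_subtopology)
  have inj: "inj_on (k \<circ> ?j) (c ` W')"
  proof (rule inj_onI)
    fix x y assume xy: "x \<in> c ` W'" "y \<in> c ` W'" "(k \<circ> ?j) x = (k \<circ> ?j) y"
    then obtain a b where ab: "a \<in> W'" "x = c a" "b \<in> W'" "y = c b" by auto
    then have "k a = k b" using xy(3) jc by simp
    moreover have "m (k a) = a" "m (k b) = b" using ab W'(3) km by auto
    ultimately show "x = y" using ab by metis
  qed
  have "open ((k \<circ> ?j) ` c ` W')"
    using invariance_of_domain[OF cont V inj] .
  moreover have "(k \<circ> ?j) ` c ` W' \<subseteq> Y"
    using jc W'(3) km by (fastforce simp: subset_iff image_iff)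
  moreover have "z \<in> (k \<circ> ?j) ` c ` W'"
    using jc[OF W'(4)] km[OF z(1)] W'(4) by force
  ultimately show ?thesis by (meson interiorI)
qed

lemma embedding_map_imp_continuous_inj:
  assumes "embedding_map X Y f"
  shows "continuous_map X Y f" "inj_on f (topspace X)"
proof -
  have h: "homeomorphic_map X (subtopology Y (f ` topspace X)) f"
    using assms by (simp add: embedding_map_def)
  show "continuous_map X Y f"
    using homeomorphic_imp_continuous_map[OF h] by (simp add: continuous_map_in_subtopology)
  show "inj_on f (topspace X)"
    using homeomorphic_imp_injective_map[OF h] .
qed

lemma norm_annulus_map [simp]: "cmod (annulus_map \<theta> \<sigma> w) = exp (- (\<sigma> * Im w))"
  by (simp add: annulus_map_def)

lemma annulus_map_real_line: "Im w = 0 \<Longrightarrow> annulus_map \<theta> \<sigma> w = cis (\<theta> (Re w))"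
  by (simp add: annulus_map_def cis_conv_exp complex_eq_iff Re_exp Im_exp)

lemma annulus_map_polar: "annulus_map \<theta> \<sigma> w = of_real (exp (- (\<sigma> * Im w))) * cis (\<theta> (Re w))"
  by (simp add: annulus_map_def complex_eq_iff Re_exp Im_exp)

text \<open>
  The upper half plane is mapped to the interior of the disk \<open>\<phi>1\<close>, the lower half plane to the
  interior of the disk \<open>\<phi>2\<close>, and the real line to a common boundary arc, on which the two
  formulas agree in the situation of interest.
\<close>

definition glued_disks ::
    "(real \<Rightarrow> real) \<Rightarrow> (complex \<Rightarrow> 'a) \<Rightarrow> (real \<Rightarrow> real) \<Rightarrow> (complex \<Rightarrow> 'a) \<Rightarrow> complex \<Rightarrow> 'a" where
  "glued_disks \<theta>1 \<phi>1 \<theta>2 \<phi>2 w =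
     (if 0 \<le> Im w then \<phi>1 (annulus_map \<theta>1 1 w) else \<phi>2 (annulus_map \<theta>2 (-1) w))"

text \<open>
  Points of different halves of the strip have different images because each open disk is disjoint
  from the other closed disk. Within a half, a point of the disk determines its radius, and its
  angle up to full turns; the injectivity of \<open>p\<close> excludes the remaining ambiguity.
\<close>

lemma glued_disks_along_arc:
  fixes p :: "real \<Rightarrow> 'a" and \<phi>1 \<phi>2 :: "complex \<Rightarrow> 'a"
  assumes \<phi>1: "embedding_map (top_of_set (cball 0 1)) S \<phi>1"
    and \<phi>2: "embedding_map (top_of_set (cball 0 1)) S \<phi>2"
    and disj: "\<phi>1 ` ball 0 1 \<inter> \<phi>2 ` cball 0 1 = {}" "\<phi>1 ` cball 0 1 \<inter> \<phi>2 ` ball 0 1 = {}"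
    and p: "inj_on p {0..1}"
    and \<theta>1: "continuous_on {0..1} \<theta>1" "\<And>s. s \<in> {0..1} \<Longrightarrow> p s = \<phi>1 (cis (\<theta>1 s))"
    and \<theta>2: "continuous_on {0..1} \<theta>2" "\<And>s. s \<in> {0..1} \<Longrightarrow> p s = \<phi>2 (cis (\<theta>2 s))"
  shows "continuous_map (top_of_set {w. Re w \<in> {0<..<1}}) S (glued_disks \<theta>1 \<phi>1 \<theta>2 \<phi>2)"
    and "inj_on (glued_disks \<theta>1 \<phi>1 \<theta>2 \<phi>2) {w. Re w \<in> {0<..<1}}"
proof -
  let ?Y = "{w. Re w \<in> {0<..<1}}"
  let ?P1 = "annulus_map \<theta>1 1" and ?P2 = "annulus_map \<theta>2 (-1)"
  let ?\<psi> = "glued_disks \<theta>1 \<phi>1 \<theta>2 \<phi>2"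
  note \<psi>_def = glued_disks_def[abs_def]
  have cm: "continuous_map (top_of_set (cball 0 1)) S \<phi>1" "continuous_map (top_of_set (cball 0 1)) S \<phi>2"
    and inj: "inj_on \<phi>1 (cball 0 1)" "inj_on \<phi>2 (cball 0 1)"
    using embedding_map_imp_continuous_inj[OF \<phi>1] embedding_map_imp_continuous_inj[OF \<phi>2] by auto
  have b1: "?P1 w \<in> cball 0 1" if "Im w \<ge> 0" for w using that by simp
  have b2: "?P2 w \<in> cball 0 1" if "Im w \<le> 0" for w using that by simp
  have o1: "?P1 w \<in> ball 0 1" if "Im w > 0" for w using that by simp
  have o2: "?P2 w \<in> ball 0 1" if "Im w < 0" for w using that by simp
  have cP1: "continuous_on ?Y ?P1" and cP2: "continuous_on ?Y ?P2"
    using \<theta>1(1) \<theta>2(1) by (auto intro: continuous_on_annulus_map)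
  have cont1: "continuous_map (subtopology (top_of_set ?Y) {w \<in> topspace (top_of_set ?Y). 0 \<le> Im w}) S (\<lambda>w. \<phi>1 (?P1 w))"
  proof -
    have "continuous_map (top_of_set (?Y \<inter> {w. 0 \<le> Im w})) (top_of_set (cball 0 1)) ?P1"
      using cP1 b1 by (auto simp: continuous_map_in_subtopology intro: continuous_on_subset)
    then have "continuous_map (top_of_set (?Y \<inter> {w. 0 \<le> Im w})) S (\<phi>1 \<circ> ?P1)"
      using cm(1) by (rule continuous_map_compose)
    moreover have "?Y \<inter> {w \<in> ?Y. 0 \<le> Im w} = ?Y \<inter> {w. 0 \<le> Im w}" by auto
    ultimately show ?thesis
      by (simp add: subtopology_subtopology o_def)
  qed
  have cont2: "continuous_map (subtopology (top_of_set ?Y) {w \<in> topspace (top_of_set ?Y). Im w \<le> 0}) S (\<lambda>w. \<phi>2 (?P2 w))"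
  proof -
    have "continuous_map (top_of_set (?Y \<inter> {w. Im w \<le> 0})) (top_of_set (cball 0 1)) ?P2"
      using cP2 b2 by (auto simp: continuous_map_in_subtopology intro: continuous_on_subset)
    then have "continuous_map (top_of_set (?Y \<inter> {w. Im w \<le> 0})) S (\<phi>2 \<circ> ?P2)"
      using cm(2) by (rule continuous_map_compose)
    moreover have "?Y \<inter> {w \<in> ?Y. Im w \<le> 0} = ?Y \<inter> {w. Im w \<le> 0}" by auto
    ultimately show ?thesis
      by (simp add: subtopology_subtopology o_def)
  qed
  have line1: "\<phi>1 (?P1 w) = p (Re w)" and line2: "\<phi>2 (?P2 w) = p (Re w)" if "w \<in> ?Y" "Im w = 0" for w
    using that \<theta>1(2)[of "Re w"] \<theta>2(2)[of "Re w"] by (simp_all add: annulus_map_real_line)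
  have cont: "continuous_map (top_of_set ?Y) S ?\<psi>"
    unfolding \<psi>_def
  proof (rule continuous_map_cases_le)
    show "continuous_map (top_of_set ?Y) euclideanreal (\<lambda>w. 0)"
      "continuous_map (top_of_set ?Y) euclideanreal Im" by (auto intro: continuous_intros)
  qed (use cont1 cont2 line1 line2 in auto)
  have ne: "p s \<noteq> p s'" if "s \<in> {0..1}" "s' \<in> {0..1}" "s \<noteq> s'" for s s'
    using that p by (meson inj_onD)
  have polar_inj: "Re w = Re w' \<and> Im w = Im w'"
    if P: "annulus_map \<theta> \<sigma> w = annulus_map \<theta> \<sigma> w'" and Y: "w \<in> ?Y" "w' \<in> ?Y" and \<sigma>: "\<sigma> \<noteq> 0"
      and p: "\<And>s. s \<in> {0..1} \<Longrightarrow> p s = \<phi> (cis (\<theta> s))" for \<theta> \<sigma> w w' and \<phi> :: "complex \<Rightarrow> 'a"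
  proof -
    from P have n: "exp (- (\<sigma> * Im w)) = exp (- (\<sigma> * Im w'))"
      by (metis norm_annulus_map)
    then have "cis (\<theta> (Re w)) = cis (\<theta> (Re w'))"
      using P unfolding annulus_map_polar n by simp
    then have "p (Re w) = p (Re w')" using Y p by simp
    then have "Re w = Re w'" using ne[of "Re w" "Re w'"] Y by auto
    with n \<sigma> show ?thesis by simp
  qed
  have "inj_on ?\<psi> ?Y"
  proof (rule inj_onI)
    have up: "w = w'" if "w \<in> ?Y" "w' \<in> ?Y" "?\<psi> w = ?\<psi> w'" "0 \<le> Im w" for w w'
    proof (cases "0 \<le> Im w'")
      case True
      then have "?P1 w = ?P1 w'" using that b1 by (auto simp: \<psi>_def intro: inj_onD[OF inj(1)])
      then show ?thesis using polar_inj[of \<theta>1 1 w w' \<phi>1] that \<theta>1(2) by (simp add: complex_eq_iff)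
    next
      case False
      then have "?\<psi> w \<in> \<phi>1 ` cball 0 1" "?\<psi> w' \<in> \<phi>2 ` ball 0 1"
        using that(4) b1[of w] o2[of w'] by (auto simp: \<psi>_def)
      then show ?thesis using that disj by auto
    qed
    fix w w' assume w: "w \<in> ?Y" "w' \<in> ?Y" "?\<psi> w = ?\<psi> w'"
    consider "0 \<le> Im w" | "0 \<le> Im w'" | "Im w < 0" "Im w' < 0" by linarith
    then show "w = w'"
    proof cases
      case 3
      then have "?P2 w = ?P2 w'" using w b2 by (auto simp: \<psi>_def intro: inj_onD[OF inj(2)])
      then show ?thesis using polar_inj[of \<theta>2 "-1" w w' \<phi>2] w \<theta>2(2) by (simp add: complex_eq_iff)
    qed (use up w in metis)+
  qed
  with cont show "continuous_map (top_of_set ?Y) S ?\<psi>" "inj_on ?\<psi> ?Y" by auto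
qed

text \<open>
  In a chart around the midpoint of the arc, the glued map satisfies all hypotheses of
  \<open>glued_annuli_not_both_positive\<close>.
\<close>

lemma positively_oriented_disks_not_same_direction:
  assumes S: "oriented_surface S A"
    and \<phi>1: "positively_oriented_disk S A F1 \<phi>1" and \<phi>2: "positively_oriented_disk S A F2 \<phi>2"
    and disj: "\<phi>1 ` ball 0 1 \<inter> \<phi>2 ` cball 0 1 = {}" "\<phi>1 ` cball 0 1 \<inter> \<phi>2 ` ball 0 1 = {}"
    and p: "inj_on p {0..1}" and d: "same_direction p \<phi>1" "same_direction p \<phi>2"
  shows False
proof -
  obtain \<theta>1 where \<theta>1: "continuous_on {0..1} \<theta>1" "strict_mono_on {0..1} \<theta>1"
    "\<And>s. s \<in> {0..1} \<Longrightarrow> p s = \<phi>1 (cis (\<theta>1 s))"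
    using d(1) unfolding same_direction_def by blast
  obtain \<theta>2 where \<theta>2: "continuous_on {0..1} \<theta>2" "strict_mono_on {0..1} \<theta>2"
    "\<And>s. s \<in> {0..1} \<Longrightarrow> p s = \<phi>2 (cis (\<theta>2 s))"
    using d(2) unfolding same_direction_def by blast
  have e: "embedding_map (top_of_set (cball 0 1)) S \<phi>1" "embedding_map (top_of_set (cball 0 1)) S \<phi>2"
    using \<phi>1 \<phi>2 by (auto simp: positively_oriented_disk_def closed_disk_def)
  have cm: "continuous_map (top_of_set (cball 0 1)) S \<phi>1" "continuous_map (top_of_set (cball 0 1)) S \<phi>2"
    and inj: "inj_on \<phi>1 (cball 0 1)" "inj_on \<phi>2 (cball 0 1)"
    using embedding_map_imp_continuous_inj[OF e(1)] embedding_map_imp_continuous_inj[OF e(2)] by auto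
  let ?Y = "{w. Re w \<in> {0<..<1}}"
  let ?\<psi> = "glued_disks \<theta>1 \<phi>1 \<theta>2 \<phi>2"
  note \<psi> = glued_disks_along_arc[OF e disj p \<theta>1(1,3) \<theta>2(1,3)]
  let ?q = "of_real (1/2) :: complex"
  have Yopen: "open ?Y"
    using open_Int[OF open_halfspace_Re_gt[of 0] open_halfspace_Re_lt[of 1]]
    by (simp add: Collect_conj_eq)
  have q: "?q \<in> ?Y" by simp
  then have "?\<psi> ?q \<in> topspace S" using \<psi>(1) by (auto simp: continuous_map_def)
  then obtain U c where c: "(U, c) \<in> A" "chart S U c" "?\<psi> ?q \<in> U"
    using S oriented_surface_chart_at by metis
  have Uo: "openin S U" using chart_embedding(3)[OF c(2)] .
  have "open {w \<in> ?Y. ?\<psi> w \<in> U}"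
    by (rule continuous_map_preimage_open[OF \<psi>(1) Yopen Uo])
  then obtain \<epsilon> where \<epsilon>: "\<epsilon> > 0" "ball ?q \<epsilon> \<subseteq> {w \<in> ?Y. ?\<psi> w \<in> U}"
    using q c(3) open_contains_ball by blast
  let ?B = "ball ?q \<epsilon>"
  have BY: "?B \<subseteq> ?Y" "?\<psi> ` ?B \<subseteq> U" using \<epsilon> by auto
  have disk: "open {z \<in> ball 0 1. \<phi> z \<in> U} \<and> orientation_preserving {z \<in> ball 0 1. \<phi> z \<in> U} (c \<circ> \<phi>)
    \<and> continuous_on {z \<in> ball 0 1. \<phi> z \<in> U} (c \<circ> \<phi>) \<and> inj_on (c \<circ> \<phi>) {z \<in> ball 0 1. \<phi> z \<in> U}"
    if \<phi>: "positively_oriented_disk S A F \<phi>" and cm: "continuous_map (top_of_set (cball 0 1)) S \<phi>"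
      and inj: "inj_on \<phi> (cball 0 1)" for F \<phi>
  proof (intro conjI)
    have "continuous_map (top_of_set (ball 0 1)) S \<phi>"
      using cm ball_subset_cball by (metis continuous_map_from_subtopology_mono)
    then show "open {z \<in> ball 0 1. \<phi> z \<in> U}"
      by (rule continuous_map_preimage_open[OF _ open_ball Uo])
    show "orientation_preserving {z \<in> ball 0 1. \<phi> z \<in> U} (c \<circ> \<phi>)"
      using \<phi> c(1) unfolding positively_oriented_disk_def by blast
    have "{z \<in> ball 0 1. \<phi> z \<in> U} \<subseteq> cball 0 1" "\<phi> ` {z \<in> ball 0 1. \<phi> z \<in> U} \<subseteq> U" by auto
    from chart_compose[OF c(2) cm this] inj
    show "continuous_on {z \<in> ball 0 1. \<phi> z \<in> U} (c \<circ> \<phi>)" "inj_on (c \<circ> \<phi>) {z \<in> ball 0 1. \<phi> z \<in> U}"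
      by auto
  qed
  note D1 = disk[OF \<phi>1 cm(1) inj(1)] and D2 = disk[OF \<phi>2 cm(2) inj(2)]
  have H: "continuous_on ?B (c \<circ> ?\<psi>)" "inj_on (c \<circ> ?\<psi>) ?B"
    using chart_compose[OF c(2) \<psi>(1) BY] \<psi>(2) by auto
  let ?I = "{0<..<1::real}"
  have mono: "continuous_on ?I \<theta>1" "strict_mono_on ?I \<theta>1" "continuous_on ?I \<theta>2" "strict_mono_on ?I \<theta>2"
    using \<theta>1 \<theta>2 by (auto intro: continuous_on_subset simp: strict_mono_on_def)
  show False
  proof (rule glued_annuli_not_both_positive[of ?B "1/2" ?I "c \<circ> ?\<psi>" \<theta>1 \<theta>2
        "{z \<in> ball 0 1. \<phi>1 z \<in> U}" "c \<circ> \<phi>1" "{z \<in> ball 0 1. \<phi>2 z \<in> U}" "c \<circ> \<phi>2"])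
    fix z assume z: "z \<in> ?B"
    then show "Re z \<in> ?I" using BY by auto
    have zU: "?\<psi> z \<in> U" "Re z \<in> ?I" using z BY by auto
    show "annulus_map \<theta>1 1 z \<in> {z \<in> ball 0 1. \<phi>1 z \<in> U} \<and> (c \<circ> ?\<psi>) z = (c \<circ> \<phi>1) (annulus_map \<theta>1 1 z)"
      if "0 < Im z"
      using that zU by (auto simp: glued_disks_def)
    show "annulus_map \<theta>2 (-1) z \<in> {z \<in> ball 0 1. \<phi>2 z \<in> U} \<and> (c \<circ> ?\<psi>) z = (c \<circ> \<phi>2) (annulus_map \<theta>2 (-1) z)"
      if "Im z < 0"
      using that zU by (auto simp: glued_disks_def)
  qed (use \<epsilon> H mono D1 D2 in auto)
qed

section \<open>Arcs on the boundary of a disk\<close>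

lemma embedding_map_inverse:
  assumes "embedding_map (top_of_set Y) S m"
  obtains k where "continuous_map (subtopology S (m ` Y)) (top_of_set Y) k" "\<forall>y\<in>Y. k (m y) = y"
proof -
  have "homeomorphic_map (top_of_set Y) (subtopology S (m ` Y)) m"
    using assms by (simp add: embedding_map_def)
  then obtain k where "homeomorphic_maps (top_of_set Y) (subtopology S (m ` Y)) m k"
    unfolding homeomorphic_map_maps ..
  then show ?thesis by (intro that[of k]) (simp_all add: homeomorphic_maps_def)
qed

text \<open>
  The angle function is the imaginary part of a continuous logarithm of the arc, read on the
  circle; being injective and continuous on an interval, it is strictly monotone.
\<close>

lemma simple_loop_arc_lift:
  fixes l :: "complex \<Rightarrow> 'a" and p :: "real \<Rightarrow> 'a"
  assumes l: "embedding_map (top_of_set (sphere 0 1)) S l"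
    and p: "pathin S p" "inj_on p {0..1}" "p ` {0..1} \<subseteq> l ` sphere 0 1"
  obtains \<theta> :: "real \<Rightarrow> real" where "continuous_on {0..1} \<theta>"
    "strict_mono_on {0..1} \<theta> \<or> strict_antimono_on {0..1} \<theta>"
    "\<And>s. s \<in> {0..1} \<Longrightarrow> p s = l (cis (\<theta> s))"
proof -
  obtain k where ck: "continuous_map (subtopology S (l ` sphere 0 1)) (top_of_set (sphere 0 1)) k"
    and kl: "\<forall>z\<in>sphere 0 1. k (l z) = z"
    by (rule embedding_map_inverse[OF l])
  have lk: "l (k (p s)) = p s" "k (p s) \<in> sphere 0 1" if "s \<in> {0..1}" for s
  proof -
    have "p s \<in> l ` sphere 0 1" using p(3) that by (rule subsetD[OF _ imageI])
    then obtain z where z: "p s = l z" "z \<in> sphere 0 1" by (rule imageE)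
    show "l (k (p s)) = p s" "k (p s) \<in> sphere 0 1"
      unfolding z(1) bspec[OF kl z(2)] by (rule refl, rule z(2))
  qed
  have "continuous_map (top_of_set {0..1}) (subtopology S (l ` sphere 0 1)) p"
    using p(1,3) by (auto simp: pathin_def continuous_map_in_subtopology)
  then have "continuous_map (top_of_set {0..1}) (top_of_set (sphere 0 1)) (k \<circ> p)"
    using ck by (rule continuous_map_compose)
  then have cont: "continuous_on {0..1} (k \<circ> p)"
    by (simp add: continuous_map_in_subtopology)
  have n1: "cmod ((k \<circ> p) s) = 1" if "s \<in> {0..1}" for s using lk(2)[OF that] by simp
  obtain q where q: "continuous_on {0..1} q" "\<And>s. s \<in> {0..1} \<Longrightarrow> (k \<circ> p) s = exp (q s)"
    using continuous_logarithm_on_contractible[OF cont] n1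
    by (metis convex_imp_contractible convex_real_interval(5) norm_zero zero_neq_one)
  define \<theta> where "\<theta> s = Im (q s)" for s
  have kp: "k (p s) = cis (\<theta> s)" if "s \<in> {0..1}" for s
  proof -
    have "exp (Re (q s)) = 1" using n1[OF that] q(2)[OF that] by (simp add: norm_exp_eq_Re)
    then show ?thesis using q(2)[OF that] by (simp add: \<theta>_def exp_eq_polar)
  qed
  have pl: "p s = l (cis (\<theta> s))" if "s \<in> {0..1}" for s
    using lk(1)[OF that] kp[OF that] by simp
  have c\<theta>: "continuous_on {0..1} \<theta>" unfolding \<theta>_def using q(1) by (rule continuous_on_Im)
  have "inj_on \<theta> {0..1}"
  proof (rule inj_onI)
    fix s t assume "s \<in> {0..1}" "t \<in> {0..1}" "\<theta> s = \<theta> t"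
    then show "s = t" using pl[of s] pl[of t] by (intro inj_onD[OF p(2)]) auto
  qed
  then have "strict_mono_on {0..1} \<theta> \<or> strict_antimono_on {0..1} \<theta>"
    using c\<theta> injective_eq_monotone_map is_interval_cc by blast
  then show ?thesis using that c\<theta> pl by blast
qed

lemma same_direction_imp_subset:
  "same_direction p l \<Longrightarrow> p ` {0..1} \<subseteq> l ` sphere 0 1"
  by (auto simp: same_direction_def)

lemma same_direction_cong:
  assumes "\<And>z. z \<in> sphere 0 1 \<Longrightarrow> l z = l' z"
  shows "same_direction p l = same_direction p l'"
proof -
  have "l (cis t) = l' (cis t)" for t by (rule assms) simp
  then show ?thesis by (simp add: same_direction_def)
qed

lemma incidence_cases:
  fixes l :: "complex \<Rightarrow> 'a" and p :: "real \<Rightarrow> 'a"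
  assumes l: "embedding_map (top_of_set (sphere 0 1)) S l"
    and p: "pathin S p" "inj_on p {0..1}"
  shows "p ` {0..1} \<subseteq> l ` sphere 0 1 \<Longrightarrow> incidence p l = 1 \<or> incidence p l = -1"
    and "\<not> p ` {0..1} \<subseteq> l ` sphere 0 1 \<Longrightarrow> incidence p l = 0"
proof -
  assume "p ` {0..1} \<subseteq> l ` sphere 0 1"
  then obtain \<theta> :: "real \<Rightarrow> real" where \<theta>: "continuous_on {0..1} \<theta>"
    "strict_mono_on {0..1} \<theta> \<or> strict_antimono_on {0..1} \<theta>"
    "\<And>s. s \<in> {0..1} \<Longrightarrow> p s = l (cis (\<theta> s))"
    using simple_loop_arc_lift[OF l p] by metis
  from \<theta>(2) show "incidence p l = 1 \<or> incidence p l = -1"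
  proof
    assume "strict_mono_on {0..1} \<theta>"
    then have "same_direction p l" using \<theta> unfolding same_direction_def by blast
    then show ?thesis by (simp add: incidence_def)
  next
    assume m: "strict_antimono_on {0..1} \<theta>"
    have "continuous_on {0..1} (\<lambda>s. \<theta> (1 - s))"
      by (rule continuous_on_compose2[OF \<theta>(1)]) (auto intro: continuous_intros)
    moreover have "strict_mono_on {0..1} (\<lambda>s. \<theta> (1 - s))"
      using m by (auto simp: monotone_on_def)
    moreover have "\<forall>s\<in>{0..1}. p (1 - s) = l (cis (\<theta> (1 - s)))" using \<theta>(3) by auto
    ultimately have "same_direction (\<lambda>s. p (1 - s)) l" unfolding same_direction_def by blast
    then show ?thesis by (simp add: incidence_def)
  qed
next
  assume n: "\<not> p ` {0..1} \<subseteq> l ` sphere 0 1"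
  have "p ` {0..1} \<subseteq> l ` sphere 0 1" if "same_direction p l \<or> same_direction (\<lambda>s. p (1 - s)) l"
    using that
  proof
    assume "same_direction (\<lambda>s. p (1 - s)) l"
    then have sub: "(\<lambda>s. p (1 - s)) ` {0..1} \<subseteq> l ` sphere 0 1"
      by (rule same_direction_imp_subset)
    show "p ` {0..1} \<subseteq> l ` sphere 0 1"
    proof
      fix x assume "x \<in> p ` {0..1}"
      then obtain s where "s \<in> {0..1}" "x = p (1 - (1 - s))" by auto
      then show "x \<in> l ` sphere 0 1" using subsetD[OF sub imageI[of "1 - s"]] by auto
    qed
  qed (rule same_direction_imp_subset)
  with n show "incidence p l = 0"
    by (metis incidence_def)
qed

text \<open>
  Equal incidence numbers would mean that both boundaries run through \<open>p\<close> in the same direction,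
  or that both run through the reversed arc in the same direction.
\<close>

lemma incidence_opposite:
  assumes S: "oriented_surface S A"
    and \<phi>1: "positively_oriented_disk S A F1 \<phi>1" and \<phi>2: "positively_oriented_disk S A F2 \<phi>2"
    and disj: "\<phi>1 ` ball 0 1 \<inter> \<phi>2 ` cball 0 1 = {}" "\<phi>1 ` cball 0 1 \<inter> \<phi>2 ` ball 0 1 = {}"
    and p: "inj_on p {0..1}"
    and i: "incidence p \<phi>1 = 1 \<or> incidence p \<phi>1 = -1" "incidence p \<phi>2 = 1 \<or> incidence p \<phi>2 = -1"
  shows "incidence p \<phi>1 + incidence p \<phi>2 = 0"
proof -
  have rev: "inj_on (\<lambda>s. p (1 - s)) {0..1}"
  proof (rule inj_onI)
    fix s t :: real assume "s \<in> {0..1}" "t \<in> {0..1}" "p (1 - s) = p (1 - t)"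
    then show "s = t" using inj_onD[OF p, of "1 - s" "1 - t"] by auto
  qed
  note N = positively_oriented_disks_not_same_direction[OF S \<phi>1 \<phi>2 disj]
  have "\<not> (same_direction p \<phi>1 \<and> same_direction p \<phi>2)"
    "\<not> (same_direction (\<lambda>s. p (1 - s)) \<phi>1 \<and> same_direction (\<lambda>s. p (1 - s)) \<phi>2)"
    using N[OF p] N[OF rev] by blast+
  with i show ?thesis
    unfolding incidence_def by (simp split: if_splits)
qed

section \<open>The two faces at an edge\<close>

text \<open>
  The setting for the local analysis of an edge. The faces are finite in number so that those that
  avoid an edge also avoid a neighbourhood of its midpoint.
\<close>

locale disk_embedded_graph =
  fixes S :: "'a topology" and A and G :: "('v, 'e) pre_digraph"
    and \<nu> :: "'v \<Rightarrow> 'a" and \<gamma> :: "'e \<Rightarrow> real \<Rightarrow> 'a"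
  assumes surface: "oriented_surface S A"
    and fin_graph: "fin_digraph G"
    and loopfree: "loopfree_digraph G"
    and cells: "closed_2_cell_embedding S G \<nu> \<gamma>"
    and finite_faces: "finite (faces S G \<nu> \<gamma>)"
begin

abbreviation "\<Gamma> \<equiv> graph_image G \<nu> \<gamma>"
abbreviation "\<F> \<equiv> faces S G \<nu> \<gamma>"

lemma Hausdorff: "Hausdorff_space S"
  using surface by (simp add: oriented_surface_def)

lemma embedding: "graph_embedding S G \<nu> \<gamma>"
  using cells by (simp add: closed_2_cell_embedding_def)

lemma finite_verts: "finite (verts G)" and finite_arcs: "finite (arcs G)"
  using fin_graph by (auto simp: fin_digraph_def fin_digraph_axioms_def)

lemma edge_pathin: "e \<in> arcs G \<Longrightarrow> pathin S (\<gamma> e)"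
  and edge_ends: "e \<in> arcs G \<Longrightarrow> \<gamma> e 0 \<in> \<nu> ` verts G \<and> \<gamma> e 1 \<in> \<nu> ` verts G \<and> \<gamma> e 0 \<noteq> \<gamma> e 1"
  and edge_interior_inj: "e \<in> arcs G \<Longrightarrow> inj_on (\<gamma> e) {0<..<1}"
  and edge_interior_verts: "e \<in> arcs G \<Longrightarrow> \<gamma> e ` {0<..<1} \<inter> \<nu> ` verts G = {}"
  and edge_interiors_disjoint: "e \<in> arcs G \<Longrightarrow> e' \<in> arcs G \<Longrightarrow> e \<noteq> e' \<Longrightarrow>
    \<gamma> e ` {0<..<1} \<inter> \<gamma> e' ` {0<..<1} = {}"
proof -
  assume e: "e \<in> arcs G"
  show "pathin S (\<gamma> e)" "inj_on (\<gamma> e) {0<..<1}" "\<gamma> e ` {0<..<1} \<inter> \<nu> ` verts G = {}"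
    using e embedding by (auto simp: graph_embedding_def)
  have "tail G e \<noteq> head G e"
    using loopfree e by (simp add: loopfree_digraph_def loopfree_digraph_axioms_def)
  moreover have "tail G e \<in> verts G" "head G e \<in> verts G"
    using fin_graph e by (auto simp: fin_digraph_def wf_digraph_def)
  ultimately show "\<gamma> e 0 \<in> \<nu> ` verts G \<and> \<gamma> e 1 \<in> \<nu> ` verts G \<and> \<gamma> e 0 \<noteq> \<gamma> e 1"
    using e embedding by (auto simp: graph_embedding_def dest: inj_onD)
next
  assume "e \<in> arcs G" "e' \<in> arcs G" "e \<noteq> e'"
  then show "\<gamma> e ` {0<..<1} \<inter> \<gamma> e' ` {0<..<1} = {}"
    using embedding unfolding graph_embedding_def by blast
qed

lemma unit_interval_split: "{0..1::real} = {0<..<1} \<union> {0, 1}" by auto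

lemma edge_inj: assumes e: "e \<in> arcs G" shows "inj_on (\<gamma> e) {0..1}"
proof (rule inj_onI)
  fix s t :: real assume s: "s \<in> {0..1}" "t \<in> {0..1}" "\<gamma> e s = \<gamma> e t"
  show "s = t"
    using s(1,2) unfolding unit_interval_split
    using s(3) edge_ends[OF e] edge_interior_verts[OF e] inj_onD[OF edge_interior_inj[OF e]]
    by (fastforce simp: image_iff)
qed

lemma edge_embedding_map: assumes e: "e \<in> arcs G" shows "embedding_map (top_of_set {0..1}) S (\<gamma> e)"
proof (rule continuous_imp_embedding_map[OF _ _ Hausdorff])
  show "continuous_map (top_of_set {0..1}) S (\<gamma> e)" using edge_pathin[OF e] by (simp add: pathin_def)
  show "compact_space (top_of_set {0..1::real})" by (simp add: compact_space_subtopology)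
  show "inj_on (\<gamma> e) (topspace (top_of_set {0..1}))" using edge_inj[OF e] by simp
qed

lemma edge_closed: assumes e: "e \<in> arcs G" shows "closedin S (\<gamma> e ` {0..1})"
proof (rule compactin_imp_closedin[OF Hausdorff])
  have "compactin (top_of_set {0..1}) {0..1::real}" by (simp add: compactin_subtopology)
  then show "compactin S (\<gamma> e ` {0..1})"
    using edge_pathin[OF e] unfolding pathin_def by (rule image_compactin)
qed

text \<open>
  Closed, and complementary in the graph to the open edge \<open>e\<close>.
\<close>

definition other_edges :: "'e \<Rightarrow> 'a set" where
  "other_edges e = \<nu> ` verts G \<union> (\<Union>e' \<in> arcs G - {e}. \<gamma> e' ` {0..1})"

lemma verts_closed: "closedin S (\<nu> ` verts G)"
  using finite_verts embedding Hausdorff_imp_t1_space[OF Hausdorff] by (simp add: graph_embedding_def t1_space_closedin_finite)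

lemma other_edges_closed: "closedin S (other_edges e)"
  unfolding other_edges_def using finite_arcs verts_closed edge_closed
  by (intro closedin_Un closedin_Union) auto

lemma edge_split:
  assumes e: "e \<in> arcs G"
  shows "\<gamma> e ` {0..1} \<subseteq> \<nu> ` verts G \<union> \<gamma> e ` {0<..<1}"
  unfolding unit_interval_split image_Un image_insert image_empty using edge_ends[OF e] by simp

lemma other_edges_disjoint: assumes e: "e \<in> arcs G" shows "\<gamma> e ` {0<..<1} \<inter> other_edges e = {}"
proof -
  have sets: "C \<subseteq> V \<union> B \<Longrightarrow> A \<inter> V = {} \<Longrightarrow> A \<inter> B = {} \<Longrightarrow> A \<inter> C = {}" for A B C V :: "'a set"
    by blast
  have "\<gamma> e ` {0<..<1} \<inter> \<gamma> e' ` {0..1} = {}" if "e' \<in> arcs G - {e}" for e'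
    using that by (intro sets[OF edge_split edge_interior_verts[OF e] edge_interiors_disjoint[OF e]]) auto
  then show ?thesis
    unfolding other_edges_def Int_Un_distrib Int_UN_distrib by (simp only: edge_interior_verts[OF e] SUP_bot_conv Un_empty) simp
qed

lemma graph_image_eq: assumes e: "e \<in> arcs G" shows "\<Gamma> = other_edges e \<union> \<gamma> e ` {0<..<1}"
proof -
  have sets: "C \<subseteq> V \<union> B \<Longrightarrow> B \<subseteq> C \<Longrightarrow> V \<union> (C \<union> R) = V \<union> R \<union> B" for B C R V :: "'a set"
    by blast
  have "(\<Union>e' \<in> arcs G. \<gamma> e' ` {0..1}) = \<gamma> e ` {0..1} \<union> (\<Union>e' \<in> arcs G - {e}. \<gamma> e' ` {0..1})"
    by (subst insert_Diff[OF e, symmetric]) (rule UN_insert)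
  moreover have "{0<..<1} \<subseteq> {0..1::real}" by (rule greaterThanLessThan_subseteq_atLeastAtMost_iff[THEN iffD2]) simp
  ultimately show ?thesis
    unfolding graph_image_def other_edges_def
    by (simp only: sets[OF edge_split[OF e] image_mono])
qed

lemma edge_subset_graph: "e \<in> arcs G \<Longrightarrow> \<gamma> e ` {0..1} \<subseteq> \<Gamma>"
  by (auto simp: graph_image_def)

lemma face_subset: "F \<in> \<F> \<Longrightarrow> F \<subseteq> topspace S - \<Gamma>"
  unfolding faces_def using connected_components_of_subset by fastforce

lemma Union_faces: "\<Union>\<F> = topspace S - \<Gamma>"
  unfolding faces_def Union_connected_components_of by auto

lemma faces_disjoint: "F \<in> \<F> \<Longrightarrow> F' \<in> \<F> \<Longrightarrow> F \<noteq> F' \<Longrightarrow> F \<inter> F' = {}"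
  unfolding faces_def using connected_components_of_overlap by blast

lemma face_disk: "F \<in> \<F> \<Longrightarrow> \<exists>\<phi>. closed_disk S F \<phi>"
  using cells by (simp add: closed_2_cell_embedding_def)

text \<open>
  A face is the image of an open disk under an injective continuous map.
\<close>

lemma face_open: assumes F: "F \<in> \<F>" shows "openin S F"
proof -
  obtain \<phi> where \<phi>: "closed_disk S F \<phi>" using face_disk[OF F] ..
  then have e: "embedding_map (top_of_set (cball 0 1)) S \<phi>" and im: "\<phi> ` ball 0 1 = F"
    by (auto simp: closed_disk_def)
  have "continuous_map (top_of_set (ball 0 1)) S \<phi>"
    using embedding_map_imp_continuous_inj(1)[OF e] ball_subset_cball
    by (metis continuous_map_from_subtopology_mono)
  moreover have "inj_on \<phi> (ball 0 1)"
    using embedding_map_imp_continuous_inj(2)[OF e] by (auto intro: inj_on_subset)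
  ultimately show ?thesis
    using surface_invariance_of_domain[OF surface open_ball] im by metis
qed

lemma closure_face_disjoint:
  assumes "F \<in> \<F>" "F' \<in> \<F>" "F \<noteq> F'"
  shows "F \<inter> S closure_of F' = {}"
  using openin_Int_closure_of_eq_empty[OF face_open[OF assms(1)]] faces_disjoint[OF assms] by blast

text \<open>
  No face meets the closure of another one, so that the closure of a face can grow only by points
  of the graph.
\<close>

lemma disk_boundary:
  assumes F: "F \<in> \<F>" and \<phi>: "closed_disk S F \<phi>"
  shows "\<phi> ` sphere 0 1 = S closure_of F \<inter> \<Gamma>"
proof -
  have e: "embedding_map (top_of_set (cball 0 1)) S \<phi>" and im: "\<phi> ` ball 0 1 = F"
    and cl: "\<phi> ` cball 0 1 = S closure_of F"
    using \<phi> by (auto simp: closed_disk_def)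
  have inj: "inj_on \<phi> (cball 0 1)" using embedding_map_imp_continuous_inj(2)[OF e] by simp
  have cb: "cball 0 1 = ball 0 1 \<union> sphere (0::complex) 1" by auto
  have d: "\<phi> ` sphere 0 1 \<inter> F = {}"
    using inj im by (fastforce simp: inj_on_def)
  have U: "S closure_of F = F \<union> \<phi> ` sphere 0 1" using cl im cb by (metis image_Un)
  have "S closure_of F \<subseteq> topspace S" by (rule closure_of_subset_topspace)
  moreover have "S closure_of F \<inter> F' = {}" if "F' \<in> \<F>" "F' \<noteq> F" for F'
    using closure_face_disjoint[OF that(1) F that(2)] by blast
  ultimately have "S closure_of F \<subseteq> \<Gamma> \<union> F"
    using Union_faces by blast
  moreover have "F \<inter> \<Gamma> = {}" using face_subset[OF F] by blast
  ultimately show ?thesis using U d by blast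
qed

lemma disk_boundary_embedding:
  assumes "closed_disk S F \<phi>"
  shows "embedding_map (top_of_set (sphere 0 1)) S \<phi>"
proof (rule continuous_imp_embedding_map[OF _ _ Hausdorff])
  have e: "embedding_map (top_of_set (cball 0 1)) S \<phi>" using assms by (simp add: closed_disk_def)
  have sub: "sphere (0::complex) 1 \<subseteq> cball 0 1" by auto
  show "continuous_map (top_of_set (sphere 0 1)) S \<phi>"
    using embedding_map_imp_continuous_inj(1)[OF e] sub
    by (metis continuous_map_from_subtopology_mono)
  show "inj_on \<phi> (topspace (top_of_set (sphere 0 1)))"
    using embedding_map_imp_continuous_inj(2)[OF e] sub by (auto intro: inj_on_subset)
  show "compact_space (top_of_set (sphere (0::complex) 1))" by (simp add: compact_space_subtopology)
qed

text \<open>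
  The parameters of the points of an edge that lie on the loop form a closed set. Inside the open
  unit interval this set is also open: the open edge is open in the graph, so a small arc of the
  loop around such a point stays in the edge, and read in the parameter of the edge it is an
  injective continuous function of the angle, hence has open image. An interval being connected, one
  common interior point suffices.
\<close>

lemma edge_in_simple_loop:
  fixes l :: "complex \<Rightarrow> 'a"
  assumes e: "e \<in> arcs G" and l: "embedding_map (top_of_set (sphere 0 1)) S l" "l ` sphere 0 1 \<subseteq> \<Gamma>"
    and s: "s \<in> {0<..<1}" "\<gamma> e s \<in> l ` sphere 0 1"
  shows "\<gamma> e ` {0..1} \<subseteq> l ` sphere 0 1"
proof -
  have lc: "continuous_map (top_of_set (sphere 0 1)) S l" and li: "inj_on l (sphere 0 1)"
    using embedding_map_imp_continuous_inj[OF l(1)] by auto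
  have "compactin (top_of_set (sphere 0 1)) (sphere (0::complex) 1)" by (simp add: compactin_subtopology)
  then have C: "closedin S (l ` sphere 0 1)"
    by (rule compactin_imp_closedin[OF Hausdorff image_compactin[OF _ lc]])
  have ge: "continuous_map (top_of_set {0..1}) S (\<gamma> e)"
    using edge_pathin[OF e] by (simp add: pathin_def)
  define K where "K = {s \<in> {0..1}. \<gamma> e s \<in> l ` sphere 0 1}"
  have "closedin (top_of_set {0..1}) K"
    using closedin_continuous_map_preimage[OF ge C] by (simp add: K_def)
  then have Kc: "closed K" by (simp add: closedin_closed_eq)
  have loc: "\<exists>V. open V \<and> s \<in> V \<and> V \<subseteq> K" if s: "s \<in> K \<inter> {0<..<1}" for s
  proof -
    have "\<gamma> e s \<in> l ` sphere 0 1" using s unfolding K_def by simp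
    then obtain z where z: "\<gamma> e s = l z" "z \<in> sphere 0 1" by (rule imageE)
    obtain t0 where t0: "z = cis t0"
    proof
      show "z = cis (Arg z)" using rcis_cmod_Arg[of z] z(2) by (simp add: rcis_def)
    qed
    let ?O = "topspace S - other_edges e"
    have O: "openin S ?O" by (rule openin_diff[OF openin_topspace other_edges_closed])
    have "continuous_on UNIV cis" by (intro continuous_intros)
    then have "continuous_map euclideanreal (top_of_set (sphere 0 1)) cis"
      by (simp add: continuous_map_in_subtopology)
    then have lcis: "continuous_map euclideanreal S (l \<circ> cis)"
      using lc by (rule continuous_map_compose)
    have "openin euclideanreal {t \<in> topspace euclideanreal. (l \<circ> cis) t \<in> ?O}"
      by (rule openin_continuous_map_preimage[OF lcis O])
    then have T: "open {t. (l \<circ> cis) t \<in> ?O}" by simp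
    have "\<gamma> e s \<in> \<gamma> e ` {0<..<1}" using s by (intro imageI) simp
    then have "\<gamma> e s \<notin> other_edges e" using other_edges_disjoint[OF e] by (metis IntI empty_iff)
    moreover have "\<gamma> e s \<in> topspace S"
      using closedin_subset[OF edge_closed[OF e]] s by (auto simp: image_subset_iff)
    ultimately have inO: "\<gamma> e s \<in> ?O" by (rule DiffI[rotated])
    then have "t0 \<in> {t. (l \<circ> cis) t \<in> ?O}" using z t0 by simp
    then obtain d where d: "d > 0" "ball t0 d \<subseteq> {t. (l \<circ> cis) t \<in> ?O}"
      using T open_contains_ball by blast
    \<comment> \<open>an arc of less than a full turn, on which \<open>cis\<close> is injective\<close>
    define J where "J = ball t0 (min d 1)"
    have Jo: "open J" "t0 \<in> J" using d by (auto simp: J_def)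
    have JO: "l (cis t) \<in> \<gamma> e ` {0<..<1}" if "t \<in> J" for t
    proof -
      have "l (cis t) \<in> ?O" using d that by (auto simp: J_def)
      moreover have "l (cis t) \<in> \<Gamma>" using l(2) by (simp add: image_subset_iff)
      ultimately show ?thesis using graph_image_eq[OF e] by (metis DiffD2 UnE)
    qed
    obtain k where kc: "continuous_map (subtopology S (\<gamma> e ` {0..1})) (top_of_set {0..1}) k"
      and ki: "\<forall>s\<in>{0..1}. k (\<gamma> e s) = s"
      by (rule embedding_map_inverse[OF edge_embedding_map[OF e]])
    have "continuous_map (top_of_set J) (subtopology S (\<gamma> e ` {0..1})) (l \<circ> cis)"
      using continuous_map_from_subtopology[OF lcis, of J] JO
      by (fastforce simp: continuous_map_in_subtopology)
    then have "continuous_map (top_of_set J) (top_of_set {0..1}) (k \<circ> (l \<circ> cis))"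
      using kc by (rule continuous_map_compose)
    then have cont: "continuous_on J (k \<circ> (l \<circ> cis))"
      by (simp add: continuous_map_in_subtopology)
    have gk: "\<gamma> e (k (l (cis t))) = l (cis t) \<and> k (l (cis t)) \<in> {0<..<1}" if "t \<in> J" for t
      using JO[OF that] ki by auto
    have inj: "inj_on (k \<circ> (l \<circ> cis)) J"
    proof (rule inj_onI)
      fix t t' assume t: "t \<in> J" "t' \<in> J" "(k \<circ> (l \<circ> cis)) t = (k \<circ> (l \<circ> cis)) t'"
      then have "l (cis t) = l (cis t')" using gk[OF t(1)] gk[OF t(2)] by (metis comp_apply)
      then have "cis t = cis t'" using li by (auto dest: inj_onD)
      moreover have "\<bar>t - t'\<bar> < 2 * pi"
        using t pi_gt3 by (auto simp: J_def dist_real_def)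
      ultimately have "\<i> * of_real t = \<i> * of_real t'"
        unfolding cis_conv_exp using exp_complex_eqI[of "\<i> * of_real t" "\<i> * of_real t'"] by simp
      then show "t = t'" by simp
    qed
    have "open ((k \<circ> (l \<circ> cis)) ` J)"
      by (rule injective_into_1d_imp_open_map_UNIV[OF Jo(1) cont inj]) simp
    moreover have "s \<in> (k \<circ> (l \<circ> cis)) ` J"
    proof (rule rev_image_eqI[OF Jo(2)])
      have "s \<in> {0..1}" using s by simp
      then have "k (\<gamma> e s) = s" by (rule bspec[OF ki])
      then show "s = (k \<circ> (l \<circ> cis)) t0" unfolding z(1) t0 by simp
    qed
    moreover have "(k \<circ> (l \<circ> cis)) ` J \<subseteq> K"
    proof
      fix x assume "x \<in> (k \<circ> (l \<circ> cis)) ` J"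
      then obtain t where "t \<in> J" "x = k (l (cis t))" by auto
      then have "\<gamma> e x = l (cis t)" "x \<in> {0<..<1}" using gk by auto
      then show "x \<in> K" by (simp add: K_def)
    qed
    ultimately show ?thesis by (intro exI conjI)
  qed
  have Ko: "open (K \<inter> {0<..<1})"
  proof (subst open_subopen, intro ballI)
    fix s assume sK: "s \<in> K \<inter> {0<..<1}"
    then obtain V where V: "open V" "s \<in> V" "V \<subseteq> K" using loc by metis
    show "\<exists>T. open T \<and> s \<in> T \<and> T \<subseteq> K \<inter> {0<..<1}"
    proof (intro exI conjI)
      show "open (V \<inter> {0<..<1})" using V(1) by (intro open_Int) auto
    qed (use V sK in auto)
  qed
  have "Topological_Spaces.connected {0<..<1::real}" by simp
  then have "K \<inter> {0<..<1} \<inter> {0<..<1} = {} \<or> -K \<inter> {0<..<1} = {}"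
  proof (rule connectedD)
    show "open (-K)" using Kc by (rule open_Compl)
  qed (use Ko in auto)
  moreover have "s \<in> K \<inter> {0<..<1} \<inter> {0<..<1}" using s by (simp add: K_def)
  ultimately have "{0<..<1} \<subseteq> K" by auto
  then have "closure {0<..<1} \<subseteq> K" using Kc by (rule closure_minimal)
  then have K1: "{0..1} \<subseteq> K" by simp
  show ?thesis
  proof
    fix x assume "x \<in> \<gamma> e ` {0..1}"
    then obtain s where "x = \<gamma> e s" "s \<in> {0..1}" by (rule imageE)
    then show "x \<in> l ` sphere 0 1" using subsetD[OF K1, of s] by (simp add: K_def)
  qed
qed

definition edge_faces :: "'e \<Rightarrow> 'a set set" where
  "edge_faces e = {F \<in> \<F>. \<gamma> e ` {0..1} \<subseteq> S closure_of F}"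

lemma edge_faces_boundary:
  assumes e: "e \<in> arcs G" and F: "F \<in> \<F>" and \<phi>: "closed_disk S F \<phi>"
  shows "F \<in> edge_faces e \<longleftrightarrow> \<gamma> e ` {0..1} \<subseteq> \<phi> ` sphere 0 1"
  unfolding disk_boundary[OF F \<phi>] edge_faces_def
  using F edge_subset_graph[OF e] by simp

text \<open>
  The boundary circle of a face is a simple loop in the graph, so that \<open>edge_in_simple_loop\<close>
  applies to it.
\<close>

lemma edge_faces_iff:
  assumes e: "e \<in> arcs G" and F: "F \<in> \<F>" and s: "s \<in> {0<..<1}"
  shows "F \<in> edge_faces e \<longleftrightarrow> \<gamma> e s \<in> S closure_of F"
proof
  assume "F \<in> edge_faces e"
  then have "\<gamma> e ` {0..1} \<subseteq> S closure_of F" by (simp add: edge_faces_def)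
  then show "\<gamma> e s \<in> S closure_of F" by (rule subsetD) (use s in auto)
next
  assume p: "\<gamma> e s \<in> S closure_of F"
  obtain \<phi> where \<phi>: "closed_disk S F \<phi>" using face_disk[OF F] ..
  have "\<gamma> e s \<in> \<Gamma>" by (rule subsetD[OF edge_subset_graph[OF e]]) (use s in auto)
  with p have "\<gamma> e s \<in> \<phi> ` sphere 0 1" unfolding disk_boundary[OF F \<phi>] by simp
  then have "\<gamma> e ` {0..1} \<subseteq> \<phi> ` sphere 0 1"
    by (intro edge_in_simple_loop[OF e disk_boundary_embedding[OF \<phi>] _ s]) (auto simp: disk_boundary[OF F \<phi>])
  then show "F \<in> edge_faces e" unfolding edge_faces_boundary[OF e F \<phi>] .
qed

lemma distinct_disks_disjoint:
  assumes F: "F1 \<in> \<F>" "F2 \<in> \<F>" "F1 \<noteq> F2" and \<phi>: "closed_disk S F1 \<phi>1" "closed_disk S F2 \<phi>2"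
  shows "\<phi>1 ` ball 0 1 \<inter> \<phi>2 ` cball 0 1 = {}" "\<phi>1 ` cball 0 1 \<inter> \<phi>2 ` ball 0 1 = {}"
proof -
  have "\<phi>1 ` ball 0 1 = F1" "\<phi>1 ` cball 0 1 = S closure_of F1"
    "\<phi>2 ` ball 0 1 = F2" "\<phi>2 ` cball 0 1 = S closure_of F2"
    using \<phi> by (auto simp: closed_disk_def)
  then show "\<phi>1 ` ball 0 1 \<inter> \<phi>2 ` cball 0 1 = {}" "\<phi>1 ` cball 0 1 \<inter> \<phi>2 ` ball 0 1 = {}"
    using closure_face_disjoint[OF F(1,2)] closure_face_disjoint[OF F(2,1)] F(3)
    by (simp_all add: Int_commute)
qed

text \<open>
  The neighbourhood is the image of the strip under the two disks glued along the edge.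
\<close>

lemma edge_neighbourhood:
  assumes e: "e \<in> arcs G" and F: "F1 \<in> edge_faces e" "F2 \<in> edge_faces e" "F1 \<noteq> F2"
  shows "\<exists>W. openin S W \<and> \<gamma> e (1/2) \<in> W \<and> W \<subseteq> F1 \<union> F2 \<union> \<Gamma>"
proof -
  have FF: "F1 \<in> \<F>" "F2 \<in> \<F>" using F by (auto simp: edge_faces_def)
  obtain \<phi>1 \<phi>2 where \<phi>: "closed_disk S F1 \<phi>1" "closed_disk S F2 \<phi>2"
    using face_disk FF by metis
  note arc = edge_pathin[OF e] edge_inj[OF e]
  have "\<gamma> e ` {0..1} \<subseteq> \<phi>1 ` sphere 0 1" "\<gamma> e ` {0..1} \<subseteq> \<phi>2 ` sphere 0 1"
    using edge_faces_boundary[OF e FF(1) \<phi>(1)] edge_faces_boundary[OF e FF(2) \<phi>(2)] F by auto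
  then obtain \<theta>1 \<theta>2 :: "real \<Rightarrow> real" where \<theta>:
    "continuous_on {0..1} \<theta>1" "\<And>s. s \<in> {0..1} \<Longrightarrow> \<gamma> e s = \<phi>1 (cis (\<theta>1 s))"
    "continuous_on {0..1} \<theta>2" "\<And>s. s \<in> {0..1} \<Longrightarrow> \<gamma> e s = \<phi>2 (cis (\<theta>2 s))"
    using simple_loop_arc_lift[OF disk_boundary_embedding[OF \<phi>(1)] arc]
      simple_loop_arc_lift[OF disk_boundary_embedding[OF \<phi>(2)] arc] by metis
  have emb: "embedding_map (top_of_set (cball 0 1)) S \<phi>1" "embedding_map (top_of_set (cball 0 1)) S \<phi>2"
    and im: "\<phi>1 ` ball 0 1 = F1" "\<phi>2 ` ball 0 1 = F2"
    using \<phi> by (auto simp: closed_disk_def)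
  let ?Y = "{w. Re w \<in> {0<..<1}}" and ?\<psi> = "glued_disks \<theta>1 \<phi>1 \<theta>2 \<phi>2"
  note \<psi> = glued_disks_along_arc[OF emb distinct_disks_disjoint[OF FF F(3) \<phi>] arc(2) \<theta>]
  have "open ?Y"
    using open_Int[OF open_halfspace_Re_gt[of 0] open_halfspace_Re_lt[of 1]] by (simp add: Collect_conj_eq)
  then have "openin S (?\<psi> ` ?Y)"
    using surface_invariance_of_domain[OF surface _ \<psi>] by blast
  moreover have "?\<psi> w \<in> F1 \<union> F2 \<union> \<Gamma>" if "w \<in> ?Y" for w
  proof (cases "Im w" "0::real" rule: linorder_cases)
    case less
    then have "?\<psi> w \<in> \<phi>2 ` ball 0 1" by (simp add: glued_disks_def)
    then show ?thesis using im by simp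
  next
    case equal
    then have "?\<psi> w = \<gamma> e (Re w)" using \<theta>(2)[of "Re w"] that by (simp add: glued_disks_def annulus_map_real_line)
    then show ?thesis using subsetD[OF edge_subset_graph[OF e], of "?\<psi> w"] that by simp
  next
    case greater
    then have "?\<psi> w \<in> \<phi>1 ` ball 0 1" by (simp add: glued_disks_def)
    then show ?thesis using im by simp
  qed
  moreover have "\<gamma> e (1/2) \<in> ?\<psi> ` ?Y"
  proof
    show "\<gamma> e (1/2) = ?\<psi> (of_real (1/2))"
      using \<theta>(2)[of "1/2"] by (simp add: glued_disks_def annulus_map_real_line)
  qed simp
  ultimately show ?thesis by blast
qed

lemma edge_faces_at_most_two:
  assumes e: "e \<in> arcs G" and F: "F1 \<in> edge_faces e" "F2 \<in> edge_faces e" "F1 \<noteq> F2"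
    and F3: "F3 \<in> edge_faces e"
  shows "F3 = F1 \<or> F3 = F2"
proof -
  obtain W where W: "openin S W" "\<gamma> e (1/2) \<in> W" "W \<subseteq> F1 \<union> F2 \<union> \<Gamma>"
    using edge_neighbourhood[OF e F] by blast
  have FF: "F1 \<in> \<F>" "F2 \<in> \<F>" "F3 \<in> \<F>" using F F3 by (auto simp: edge_faces_def)
  have "\<gamma> e (1/2) \<in> S closure_of F3"
    using edge_faces_iff[OF e FF(3), of "1/2"] F3 by simp
  then obtain x where x: "x \<in> F3" "x \<in> W"
    using W(1,2) unfolding in_closure_of by blast
  then have "x \<in> F1 \<union> F2" using W(3) face_subset[OF FF(3)] by blast
  then show ?thesis using faces_disjoint[OF FF(3,1)] faces_disjoint[OF FF(3,2)] x by blast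
qed

text \<open>
  The closures of the faces that do not contain the edge form a closed set, by finiteness, which
  stays away from the midpoint of the edge.
\<close>

lemma edge_neighbourhood_edge_faces:
  assumes e: "e \<in> arcs G"
  shows "\<exists>W. openin S W \<and> \<gamma> e (1/2) \<in> W \<and> W \<subseteq> \<gamma> e ` {0..1} \<union> \<Union>(edge_faces e)"
proof -
  let ?C = "\<Union>F \<in> \<F> - edge_faces e. S closure_of F"
  let ?W = "topspace S - (other_edges e \<union> ?C)"
  have "closedin S ?C" using finite_faces by (intro closedin_Union) auto
  then have "openin S ?W" using other_edges_closed by (intro openin_diff) auto
  moreover have "\<gamma> e (1/2) \<in> ?W"
  proof -
    have in1: "\<gamma> e (1/2) \<in> \<gamma> e ` {0<..<1}" and in2: "\<gamma> e (1/2) \<in> \<gamma> e ` {0..1}"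
      by (rule imageI; simp)+
    have "\<gamma> e (1/2) \<in> topspace S" using closedin_subset[OF edge_closed[OF e]] in2 by (rule subsetD)
    moreover have "\<gamma> e (1/2) \<notin> other_edges e"
      using other_edges_disjoint[OF e] in1 by (metis IntI empty_iff)
    moreover have "\<gamma> e (1/2) \<notin> ?C"
    proof
      assume "\<gamma> e (1/2) \<in> ?C"
      then obtain F where "F \<in> \<F> - edge_faces e" "\<gamma> e (1/2) \<in> S closure_of F" by (rule UN_E)
      then show False using edge_faces_iff[OF e, of F "1/2"] by simp
    qed
    ultimately show ?thesis by simp
  qed
  moreover have "?W \<subseteq> \<gamma> e ` {0..1} \<union> \<Union>(edge_faces e)"
  proof
    fix x assume x: "x \<in> ?W"
    show "x \<in> \<gamma> e ` {0..1} \<union> \<Union>(edge_faces e)"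
    proof (cases "x \<in> \<Gamma>")
      case True
      then have "x \<in> \<gamma> e ` {0<..<1}" using graph_image_eq[OF e] x by simp
      then show ?thesis by auto
    next
      case False
      then obtain F where F: "F \<in> \<F>" "x \<in> F" using x Union_faces by blast
      then have "x \<in> S closure_of F"
        using closure_of_subset[of F S] face_subset by blast
      then have "F \<in> edge_faces e" using x F by auto
      then show ?thesis using F by blast
    qed
  qed
  ultimately show ?thesis by blast
qed

text \<open>
  With no face at the edge, a segment would be a neighbourhood of its midpoint in the plane; with
  one face only, a point of the unit circle would be interior to the closed unit disk.
\<close>

theorem edge_faces_two:
  assumes e: "e \<in> arcs G"
  shows "\<exists>F1 F2. F1 \<noteq> F2 \<and> edge_faces e = {F1, F2}"
proof -
  obtain W where W: "openin S W" "\<gamma> e (1/2) \<in> W" "W \<subseteq> \<gamma> e ` {0..1} \<union> \<Union>(edge_faces e)"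
    using edge_neighbourhood_edge_faces[OF e] by blast
  have "edge_faces e \<noteq> {}"
  proof
    assume "edge_faces e = {}"
    \<comment> \<open>the edge, as an embedded segment of the complex plane\<close>
    let ?I = "complex_of_real ` {0..1}"
    have "continuous_map (top_of_set ?I) (top_of_set {0..1}) Re"
      by (auto simp: continuous_map_in_subtopology intro: continuous_intros)
    then have "continuous_map (top_of_set ?I) S (\<gamma> e \<circ> Re)"
      using edge_pathin[OF e] unfolding pathin_def by (rule continuous_map_compose)
    moreover have "compact_space (top_of_set ?I)"
      by (intro compact_space_subtopology) (auto intro!: compact_continuous_image continuous_intros)
    moreover have "inj_on (\<gamma> e \<circ> Re) (topspace (top_of_set ?I))"
      using edge_inj[OF e] by (auto simp: inj_on_def)
    ultimately have "embedding_map (top_of_set ?I) S (\<gamma> e \<circ> Re)"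
      using continuous_imp_embedding_map Hausdorff by blast
    moreover have "(\<gamma> e \<circ> Re) ` ?I = \<gamma> e ` {0..1}" by (simp add: image_image)
    then have "W \<subseteq> (\<gamma> e \<circ> Re) ` ?I" using W(3) \<open>edge_faces e = {}\<close> by simp
    moreover have "of_real (1/2) \<in> ?I" by (rule imageI) simp
    ultimately have "of_real (1/2) \<in> interior ?I"
      using W(1,2) by (intro surface_neighbourhood_interior[OF surface, of ?I "\<gamma> e \<circ> Re" W]) auto
    moreover have "interior ?I \<subseteq> interior {z. Im z = 0}" by (rule interior_mono) auto
    moreover have "interior {z. Im z = 0} = {}"
      using interior_hyperplane[of \<i> 0] by (simp add: inner_complex_def)
    ultimately show False by blast
  qed
  then obtain F1 where F1: "F1 \<in> edge_faces e" by blast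
  have "\<exists>F2 \<in> edge_faces e. F2 \<noteq> F1"
  proof (rule ccontr)
    assume "\<not> (\<exists>F2 \<in> edge_faces e. F2 \<noteq> F1)"
    then have only: "edge_faces e = {F1}" using F1 by blast
    have F: "F1 \<in> \<F>" using F1 by (simp add: edge_faces_def)
    obtain \<phi> where \<phi>: "closed_disk S F1 \<phi>" using face_disk[OF F] ..
    then have emb: "embedding_map (top_of_set (cball 0 1)) S \<phi>" and im: "\<phi> ` cball 0 1 = S closure_of F1"
      by (auto simp: closed_disk_def)
    have b: "\<gamma> e ` {0..1} \<subseteq> \<phi> ` sphere 0 1"
      using edge_faces_boundary[OF e F \<phi>] F1 by simp
    have "\<gamma> e (1/2) \<in> \<phi> ` sphere 0 1" by (rule subsetD[OF b imageI]) simp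
    then obtain z where z: "\<gamma> e (1/2) = \<phi> z" "z \<in> sphere 0 1" by (rule imageE)
    have "\<gamma> e ` {0..1} \<subseteq> S closure_of F1" using F1 by (simp add: edge_faces_def)
    moreover have "F1 \<subseteq> S closure_of F1"
      using closure_of_subset[of F1 S] face_subset[OF F] by blast
    moreover have "\<Union>(edge_faces e) = F1" using only by simp
    ultimately have Wc: "W \<subseteq> \<phi> ` cball 0 1" using W(3) unfolding im by (metis Un_least order_trans)
    have "z \<in> interior (cball 0 1)"
    proof (rule surface_neighbourhood_interior[OF surface emb W(1) Wc])
      show "z \<in> cball 0 1" using z(2) by simp
      show "\<phi> z \<in> W" using W(2) unfolding z(1) .
    qed
    then show False using z(2) by simp
  qed
  then obtain F2 where F2: "F2 \<in> edge_faces e" "F2 \<noteq> F1" by blast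
  have "edge_faces e = {F1, F2}"
  proof (intro equalityI subsetI)
    fix F3 assume "F3 \<in> edge_faces e"
    then show "F3 \<in> {F1, F2}"
      using edge_faces_at_most_two[OF e F1 F2(1) F2(2)[symmetric]] by simp
  qed (use F1 F2 in auto)
  then show ?thesis using F2(2)[symmetric] by (intro exI conjI)
qed

end

section \<open>Rank of the first homology\<close>

text \<open>
  The coordinates with respect to the basis give the isomorphism.
\<close>

lemma integral_basis_imp_iso_free_Abelian_group:
  fixes I :: "'i set"
  assumes H: "comm_group H" and b: "integral_basis H I b"
  shows "free_Abelian_group I \<cong> H"
proof -
  interpret comm_group H by (rule H)
  have fin: "finite I" and bI: "\<And>k. k \<in> I \<Longrightarrow> b k \<in> carrier H"
    and ex: "\<And>x. x \<in> carrier H \<Longrightarrow>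
      \<exists>!m :: 'i \<Rightarrow> int. m \<in> I \<rightarrow>\<^sub>E UNIV \<and> x = (\<Otimes>\<^bsub>H\<^esub>k\<in>I. b k [^]\<^bsub>H\<^esub> m k)"
    using b by (auto simp: integral_basis_def)
  define h where "h c = (\<Otimes>\<^bsub>H\<^esub>k\<in>I. b k [^]\<^bsub>H\<^esub> (Poly_Mapping.lookup c k :: int))" for c
  have hc: "h c \<in> carrier H" for c
    unfolding h_def by (rule finprod_closed) (use bI in auto)
  have hr: "h c = (\<Otimes>\<^bsub>H\<^esub>k\<in>I. b k [^]\<^bsub>H\<^esub> restrict (Poly_Mapping.lookup c) I k)" for c
    unfolding h_def by (rule finprod_cong') (use bI in auto)
  have "h \<in> iso (free_Abelian_group I) H"
    unfolding iso_def
  proof (intro CollectI conjI homI)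
    show "h (x \<otimes>\<^bsub>free_Abelian_group I\<^esub> y) = h x \<otimes>\<^bsub>H\<^esub> h y" for x y
    proof -
      have "h (x \<otimes>\<^bsub>free_Abelian_group I\<^esub> y) =
        (\<Otimes>\<^bsub>H\<^esub>k\<in>I. b k [^]\<^bsub>H\<^esub> Poly_Mapping.lookup x k \<otimes>\<^bsub>H\<^esub> b k [^]\<^bsub>H\<^esub> Poly_Mapping.lookup y k)"
        unfolding h_def mult_free_Abelian_group lookup_add
        by (rule finprod_cong') (use bI in \<open>auto simp: int_pow_mult\<close>)
      also have "\<dots> = h x \<otimes>\<^bsub>H\<^esub> h y"
        unfolding h_def by (rule finprod_multf) (use bI in auto)
      finally show ?thesis .
    qed
    show "bij_betw h (carrier (free_Abelian_group I)) (carrier H)"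
    proof (rule bij_betw_imageI)
      show "inj_on h (carrier (free_Abelian_group I))"
      proof (rule inj_onI)
        fix x y assume x: "x \<in> carrier (free_Abelian_group I)" and y: "y \<in> carrier (free_Abelian_group I)"
          and eq: "h x = h y"
        obtain m0 where m0: "\<forall>m :: 'i \<Rightarrow> int. m \<in> I \<rightarrow>\<^sub>E UNIV \<and> h x = (\<Otimes>\<^bsub>H\<^esub>k\<in>I. b k [^]\<^bsub>H\<^esub> m k) \<longrightarrow> m = m0"
          using ex[OF hc[of x]] by (rule ex1E) (erule that)
        have "restrict (Poly_Mapping.lookup x) I = m0"
          by (rule m0[rule_format], rule conjI, simp, rule hr)
        moreover have "restrict (Poly_Mapping.lookup y) I = m0"
          by (rule m0[rule_format], rule conjI, simp, rule trans[OF eq hr])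
        ultimately have "restrict (Poly_Mapping.lookup x) I = restrict (Poly_Mapping.lookup y) I" by simp
        moreover have "Poly_Mapping.lookup x k = Poly_Mapping.lookup y k"
          if "restrict (Poly_Mapping.lookup x) I = restrict (Poly_Mapping.lookup y) I" for k
        proof (cases "k \<in> I")
          case True
          then show ?thesis using fun_cong[OF that, of k] by simp
        next
          case False
          then have "k \<notin> Poly_Mapping.keys x" "k \<notin> Poly_Mapping.keys y" using x y by auto
          then show ?thesis by (simp add: in_keys_iff)
        qed
        ultimately show "x = y" by (intro poly_mapping_eqI) simp
      qed
      show "h ` carrier (free_Abelian_group I) = carrier H"
      proof (intro equalityI subsetI)
        fix x assume "x \<in> carrier H"
        then obtain m :: "'i \<Rightarrow> int" where m: "x = (\<Otimes>\<^bsub>H\<^esub>k\<in>I. b k [^]\<^bsub>H\<^esub> m k)"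
          using ex by blast
        define c where "c = Abs_poly_mapping (\<lambda>k. if k \<in> I then m k else 0)"
        have lc: "Poly_Mapping.lookup c = (\<lambda>k. if k \<in> I then m k else 0)"
          unfolding c_def by (rule lookup_Abs_poly_mapping) (use fin in auto)
        have "c \<in> carrier (free_Abelian_group I)"
          by (auto simp: in_keys_iff lc split: if_splits)
        moreover have "h c = x"
          unfolding h_def m lc by (rule finprod_cong') (use bI in auto)
        ultimately show "x \<in> h ` carrier (free_Abelian_group I)" by blast
      qed (use hc in auto)
    qed
  qed (rule hc)
  then show ?thesis by (auto simp: is_iso_def)
qed

lemma homology_basis_card:
  assumes "homology_basis X I l" and "has_first_betti_number X r"
  shows "card I = r"
proof -
  let ?H = "homology_group 1 X"
  have H: "comm_group ?H" by (simp add: abelian_homology_group)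
  have b: "integral_basis ?H I (\<lambda>k. loop_class X (l k))"
    using assms(1) by (simp add: homology_basis_def)
  have "free_Abelian_group I \<cong> ?H"
    using integral_basis_imp_iso_free_Abelian_group[OF H b] .
  moreover have "?H \<cong> free_Abelian_group {..<r}"
    using assms(2) by (simp add: has_first_betti_number_def)
  ultimately have "free_Abelian_group I \<cong> free_Abelian_group {..<r}"
    by (rule iso_trans)
  then have "I \<approx> {..<r}" by (simp add: isomorphic_free_Abelian_groups)
  moreover have "finite I" using b by (simp add: integral_basis_def)
  ultimately show ?thesis using eqpoll_iff_card[of I "{..<r}"] by simp
qed

section \<open>The divisor and the matrix entries\<close>

text \<open>
  Pairs of faces, listed in increasing order: \<open>0, ..., m - 1\<close> stand for the internal faces and
  \<open>m\<close> stands for the external face.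
\<close>

definition face_pairs :: "nat \<Rightarrow> (nat \<times> nat) set" where
  "face_pairs m = {(i, j). i < j \<and> j \<le> m}"

lemma finite_face_pairs: "finite (face_pairs m)"
  by (rule finite_subset[of _ "{..m} \<times> {..m}"]) (auto simp: face_pairs_def)

lemma card_face_pairs: "card (face_pairs m) = Suc m choose 2"
proof (induction m)
  case (Suc m)
  have "face_pairs (Suc m) = face_pairs m \<union> (\<lambda>i. (i, Suc m)) ` {..m}"
    by (auto simp: face_pairs_def le_Suc_eq)
  moreover have "card ((\<lambda>i. (i, Suc m)) ` {..m}) = Suc m"
    by (subst card_image) (auto simp: inj_on_def)
  moreover have "face_pairs m \<inter> (\<lambda>i. (i, Suc m)) ` {..m} = {}"
    by (auto simp: face_pairs_def)
  ultimately have "card (face_pairs (Suc m)) = (Suc m choose 2) + Suc m"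
    using Suc.IH by (simp add: card_Un_disjoint finite_face_pairs)
  then show ?case by (simp add: numeral_2_eq_2)
next
  case 0
  have "face_pairs 0 = {}" by (auto simp: face_pairs_def)
  then show ?case by (simp add: numeral_2_eq_2)
qed

text \<open>
  The linear equation that belongs to a pair of faces: a matrix entry for two internal faces, and a
  row sum over the internal faces if one of the faces is the external one.
\<close>

definition pair_value :: "nat \<Rightarrow> nat \<times> nat \<Rightarrow> 'k :: field mat \<Rightarrow> 'k" where
  "pair_value m = (\<lambda>(i, j) x. if j < m then x $$ (i, j) else \<Sum>k<m. x $$ (i, k))"

definition pair_component :: "nat \<Rightarrow> nat \<Rightarrow> nat \<times> nat \<Rightarrow> 'k :: field mat set" where
  "pair_component ell m p = {x \<in> carrier_mat ell ell. pair_value m p x = 0}"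

definition pair_form :: "nat \<Rightarrow> nat \<Rightarrow> nat \<times> nat \<Rightarrow> 'k :: field mat" where
  "pair_form ell m = (\<lambda>(i, j). mat ell ell (\<lambda>(r, s). of_bool (r = i \<and> (if j < m then s = j else s < m))))"

lemma pair_form_index:
  "r < ell \<Longrightarrow> s < ell \<Longrightarrow>
    pair_form ell m (i, j) $$ (r, s) = of_bool (r = i \<and> (if j < m then s = j else s < m))"
  by (simp add: pair_form_def)

lemma linear_form_pair_form:
  assumes "m \<le> ell" "(i, j) \<in> face_pairs m"
  shows "linear_form ell (pair_form ell m (i, j)) x = pair_value m (i, j) x"
proof -
  have i: "i < ell" using assms by (auto simp: face_pairs_def)
  have "linear_form ell (pair_form ell m (i, j)) x =
      (\<Sum>r<ell. if r = i then (\<Sum>s<ell. of_bool (if j < m then s = j else s < m) * x $$ (i, s)) else 0)"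
    unfolding linear_form_def by (intro sum.cong refl) (auto simp: pair_form_index)
  also have "\<dots> = (\<Sum>s<ell. of_bool (if j < m then s = j else s < m) * x $$ (i, s))"
    using i by simp
  also have "\<dots> = pair_value m (i, j) x"
  proof (cases "j < m")
    case True
    then have "(\<Sum>s<ell. of_bool (if j < m then s = j else s < m) * x $$ (i, s))
        = (\<Sum>s<ell. if s = j then x $$ (i, s) else 0)"
      by (intro sum.cong) auto
    then show ?thesis using True assms(1) by (simp add: pair_value_def)
  next
    case False
    then have "(\<Sum>s<ell. of_bool (if j < m then s = j else s < m) * x $$ (i, s))
        = (\<Sum>s<m. x $$ (i, s))"
      using assms(1) by (intro sum.mono_neutral_cong_right) auto
    then show ?thesis using False by (simp add: pair_value_def)
  qed
  finally show ?thesis .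
qed

text \<open>
  All forms together are linearly independent, in triangular fashion: the diagonal entry
  \<open>(i, i)\<close> occurs only in the sum over row \<open>i\<close>, which eliminates the row sums, and what is left
  are distinct coordinates above the diagonal.
\<close>

lemma normal_crossings_pair_components:
  fixes e :: "nat \<Rightarrow> nat \<times> nat"
  assumes m: "m \<le> ell" and e: "bij_betw e {..<N} (face_pairs m)"
  shows "normal_crossings_linear_divisor ell N (\<lambda>k. pair_component ell m (e k) :: 'k :: field mat set)"
  unfolding normal_crossings_linear_divisor_def
proof (intro exI conjI allI impI ballI)
  let ?A = "\<lambda>k. pair_form ell m (e k) :: 'k mat"
  have ep: "e k \<in> face_pairs m" if "k < N" for k
    using e that by (auto simp: bij_betw_def)
  fix k assume k: "k < N"
  show "?A k \<in> carrier_mat ell ell"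
    by (simp add: pair_form_def split: prod.split)
  show "pair_component ell m (e k) = {x \<in> carrier_mat ell ell. linear_form ell (?A k) x = 0}"
  proof -
    have "linear_form ell (?A k) x = pair_value m (e k) x" for x
      using linear_form_pair_form[OF m, of "fst (e k)" "snd (e k)" x] ep[OF k] by simp
    then show ?thesis by (simp add: pair_component_def)
  qed
next
  let ?A = "\<lambda>k. pair_form ell m (e k) :: 'k mat"
  fix p :: "'k mat" and c :: "nat \<Rightarrow> 'k" and k
  let ?K = "{k. k < N \<and> p \<in> pair_component ell m (e k)}"
  assume zero: "\<forall>i<ell. \<forall>j<ell. (\<Sum>k\<in>?K. c k * ?A k $$ (i, j)) = 0"
    and k: "k < N" "p \<in> pair_component ell m (e k)"
  have ep: "e k \<in> face_pairs m" if "k < N" for k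
    using e that by (auto simp: bij_betw_def)
  have einj: "k = k'" if "k < N" "k' < N" "e k = e k'" for k k'
    using e that by (auto simp: bij_betw_def inj_on_def)
  have only: "c k = 0" if k: "k \<in> ?K" and ij: "i < ell" "j < ell" and one: "?A k $$ (i, j) = 1"
    and others: "\<And>k'. k' \<in> ?K \<Longrightarrow> k' \<noteq> k \<Longrightarrow> c k' * ?A k' $$ (i, j) = 0" for k i j
  proof -
    have "(\<Sum>k'\<in>?K. c k' * ?A k' $$ (i, j)) = (\<Sum>k'\<in>{k}. c k' * ?A k' $$ (i, j))"
      using k others by (intro sum.mono_neutral_right) auto
    then show ?thesis using zero ij one by simp
  qed
  have row: "c k = 0" if k: "k \<in> ?K" and ek: "e k = (i, m)" for k i
  proof (rule only[OF k, of i i])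
    show i: "i < ell" "i < ell" using ep[of k] k ek m by (auto simp: face_pairs_def)
    show "?A k $$ (i, i) = 1"
      using ep[of k] k ek i by (auto simp: pair_form_index face_pairs_def)
    fix k' assume k': "k' \<in> ?K" "k' \<noteq> k"
    obtain i' j' where e': "e k' = (i', j')" by (cases "e k'")
    have "i' < j'" "j' \<le> m" using ep[of k'] k' e' by (auto simp: face_pairs_def)
    moreover have "(i', j') \<noteq> (i, m)" using einj[of k' k] k' k ek e' by auto
    ultimately show "c k' * ?A k' $$ (i, i) = 0"
      using i by (auto simp: e' pair_form_index)
  qed
  show "c k = 0"
  proof -
    obtain i j where ek: "e k = (i, j)" by (cases "e k")
    have ij: "i < j" "j \<le> m" using ep[of k] k ek by (auto simp: face_pairs_def)
    show ?thesis
    proof (cases "j = m")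
      case True
      then show ?thesis using row[of k i] k ek by simp
    next
      case False
      then have jm: "j < m" using ij by simp
      show ?thesis
      proof (rule only[of k i j])
        show i: "i < ell" "j < ell" using ij m jm by auto
        show "?A k $$ (i, j) = 1" using i jm ek by (simp add: pair_form_index)
        fix k' assume k': "k' \<in> ?K" "k' \<noteq> k"
        obtain i' j' where e': "e k' = (i', j')" by (cases "e k'")
        have ij': "i' < j'" "j' \<le> m" using ep[of k'] k' e' by (auto simp: face_pairs_def)
        show "c k' * ?A k' $$ (i, j) = 0"
        proof (cases "j' = m")
          case True
          then show ?thesis using row[OF k'(1), of i'] e' by simp
        next
          case False
          moreover have "(i', j') \<noteq> (i, j)" using einj[of k' k] k' k ek e' by auto
          ultimately show ?thesis using i ij' by (auto simp: e' pair_form_index)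
        qed
      qed (use k in simp)
    qed
  qed
qed

lemma pair_components_eq:
  "pair_component ell m ` face_pairs m =
      {{x \<in> carrier_mat ell ell. x $$ (i, j) = 0} | i j. i < j \<and> j < m} \<union>
      {{x \<in> carrier_mat ell ell. (\<Sum>j<m. x $$ (i, j)) = 0} | i. i < m}"
proof -
  have split: "face_pairs m = {(i, j). i < j \<and> j < m} \<union> (\<lambda>i. (i, m)) ` {..<m}"
    by (auto simp: face_pairs_def le_less)
  have 1: "pair_component ell m ` {(i, j). i < j \<and> j < m} =
      {{x \<in> carrier_mat ell ell. x $$ (i, j) = 0} | i j. i < j \<and> j < m}"
    by (force simp: pair_component_def pair_value_def image_iff)
  have 2: "pair_component ell m ` (\<lambda>i. (i, m)) ` {..<m} =
      {{x \<in> carrier_mat ell ell. (\<Sum>j<m. x $$ (i, j)) = 0} | i. i < m}"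
    by (auto simp: pair_component_def pair_value_def image_iff)
  show ?thesis unfolding split image_Un 1 2 ..
qed

lemma tau_map_index:
  assumes "\<eta> \<in> carrier_mat n ell" "t \<in> carrier_vec n" "i < ell" "j < ell"
  shows "tau_map \<eta> t $$ (i, j) = (\<Sum>q<n. \<eta> $$ (q, i) * \<eta> $$ (q, j) * vec_index t q)"
proof -
  have D: "mat_diag n (vec_index t) * \<eta> = mat n ell (\<lambda>(q, j). vec_index t q * \<eta> $$ (q, j))"
    using assms(1) by (rule mat_diag_mult_left)
  have "tau_map \<eta> t = transpose_mat \<eta> * (mat_diag n (vec_index t) * \<eta>)"
    unfolding tau_map_def using assms by (subst assoc_mult_mat[of _ ell n _ n _ ell]) auto
  then show ?thesis
    unfolding D using assms
    by (simp add: scalar_prod_def mult_ac lessThan_atLeast0)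
qed

lemma tau_map_carrier:
  assumes "\<eta> \<in> carrier_mat n ell" "t \<in> carrier_vec n"
  shows "tau_map \<eta> t \<in> carrier_mat ell ell"
proof -
  have "dim_vec t = n" using assms(2) by (rule carrier_vecD)
  then show ?thesis
    unfolding tau_map_def using assms(1)
    by (intro mult_carrier_mat[of _ ell n]) (simp_all add: mat_diag_dim)
qed

text \<open>
  Here \<open>I\<close> is the matrix of incidence numbers, restricted to the internal faces, and \<open>ed q\<close> is the
  pair of faces at the edge \<open>q\<close>. The value of the form of that pair is \<open>- t\<^sub>q\<close> for two internal
  faces. If the second face is the external one, the value is \<open>t\<^sub>q\<close>, because the opposite incidence
  numbers at any edge between two internal faces cancel in the row sum.
\<close>

lemma pair_value_tau_map:
  fixes I :: "nat \<Rightarrow> nat \<Rightarrow> int" and \<eta> :: "'k :: field mat"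
  assumes \<eta>: "\<eta> \<in> carrier_mat n ell" and t: "t \<in> carrier_vec n" and m: "m \<le> ell"
    and \<eta>I: "\<And>q k. q < n \<Longrightarrow> k < m \<Longrightarrow> \<eta> $$ (q, k) = of_int (I q k)"
    and ed: "\<And>q. q < n \<Longrightarrow> ed q \<in> face_pairs m" "inj_on ed {..<n}"
    and unit: "\<And>q k. q < n \<Longrightarrow> k < m \<Longrightarrow> k = fst (ed q) \<or> k = snd (ed q) \<Longrightarrow> I q k = 1 \<or> I q k = -1"
    and null: "\<And>q k. q < n \<Longrightarrow> k < m \<Longrightarrow> k \<noteq> fst (ed q) \<Longrightarrow> k \<noteq> snd (ed q) \<Longrightarrow> I q k = 0"
    and opp: "\<And>q. q < n \<Longrightarrow> snd (ed q) < m \<Longrightarrow> I q (fst (ed q)) + I q (snd (ed q)) = 0"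
    and q: "q < n"
  shows "pair_value m (ed q) (tau_map \<eta> t) = 0 \<longleftrightarrow> vec_index t q = 0"
proof -
  obtain a b where ab: "ed q = (a, b)" by (cases "ed q")
  have lt: "a < b" "b \<le> m" using ed(1)[OF q] ab by (auto simp: face_pairs_def)
  have am: "a < m" using lt by simp
  have other: "ed q' \<noteq> (a, b)" if "q' < n" "q' \<noteq> q" for q'
    using inj_onD[OF ed(2), of q' q] that q ab by auto
  have entry: "tau_map \<eta> t $$ (i, j) = (\<Sum>q<n. of_int (I q i * I q j) * vec_index t q)"
    if "i < m" "j < m" for i j
    using that m by (subst tau_map_index[OF \<eta> t]) (auto simp: \<eta>I intro!: sum.cong)
  show ?thesis
  proof (cases "b = m")
    case False
    then have bm: "b < m" using lt by simp
    have "tau_map \<eta> t $$ (a, b) = (\<Sum>q'\<in>{q}. of_int (I q' a * I q' b) * vec_index t q')"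
      unfolding entry[OF am bm]
    proof (rule sum.mono_neutral_right)
      show "\<forall>q'\<in>{..<n} - {q}. of_int (I q' a * I q' b) * vec_index t q' = 0"
      proof
        fix q' assume q': "q' \<in> {..<n} - {q}"
        have "I q' a = 0 \<or> I q' b = 0"
        proof (rule ccontr)
          assume "\<not> (I q' a = 0 \<or> I q' b = 0)"
          then have "a = fst (ed q') \<or> a = snd (ed q')" "b = fst (ed q') \<or> b = snd (ed q')"
            using null[of q' a] null[of q' b] q' am bm by auto
          moreover have "fst (ed q') < snd (ed q')" using ed(1)[of q'] q' by (auto simp: face_pairs_def)
          ultimately have "ed q' = (a, b)" using lt by (auto simp: prod_eq_iff)
          then show False using other[of q'] q' by auto
        qed
        then show "of_int (I q' a * I q' b) * vec_index t q' = 0" by auto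
      qed
    qed (use q in auto)
    moreover have "I q a * I q b = -1"
      using unit[OF q am] unit[OF q bm] opp[OF q] ab bm by auto
    ultimately show ?thesis by (simp add: ab pair_value_def bm)
  next
    case True
    have rowsum: "I q' a * (\<Sum>j<m. I q' j) = of_bool (q' = q)" if q': "q' < n" for q'
    proof (cases "a = fst (ed q') \<or> a = snd (ed q')")
      case False
      then have "I q' a = 0" using null[OF q' am] by auto
      moreover have "q' \<noteq> q" using False ab by auto
      ultimately show ?thesis by simp
    next
      case a: True
      obtain a' b' where ab': "ed q' = (a', b')" by (cases "ed q'")
      have lt': "a' < b'" "b' \<le> m" using ed(1)[OF q'] ab' by (auto simp: face_pairs_def)
      show ?thesis
      proof (cases "b' = m")
        case b': True
        then have "a' = a" using a ab' am by auto
        then have eq: "q' = q" using other[OF q'] ab' b' True by auto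
        have "(\<Sum>j<m. I q j) = (\<Sum>j\<in>{a}. I q j)"
          using am null[OF q] ab True by (intro sum.mono_neutral_right) auto
        then show ?thesis using unit[OF q am] ab eq by auto
      next
        case False
        then have "(\<Sum>j<m. I q' j) = (\<Sum>j\<in>{a', b'}. I q' j)"
          using lt' null[OF q'] ab' by (intro sum.mono_neutral_right) auto
        also have "\<dots> = 0" using opp[OF q'] lt' False ab' by simp
        finally show ?thesis using False ab True ab' by auto
      qed
    qed
    have "(\<Sum>j<m. tau_map \<eta> t $$ (a, j)) = (\<Sum>j<m. \<Sum>q'<n. of_int (I q' a * I q' j) * vec_index t q')"
      using entry[OF am] by simp
    also have "\<dots> = (\<Sum>q'<n. \<Sum>j<m. of_int (I q' a * I q' j) * vec_index t q')"
      by (rule sum.swap)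
    also have "\<dots> = (\<Sum>q'<n. of_int (I q' a * (\<Sum>j<m. I q' j)) * vec_index t q')"
      by (simp add: sum_distrib_left sum_distrib_right)
    also have "\<dots> = (\<Sum>q'<n. if q' = q then vec_index t q' else 0)"
      using rowsum by (intro sum.cong) auto
    also have "\<dots> = vec_index t q" using q by simp
    finally show ?thesis by (simp add: ab pair_value_def True)
  qed
qed

section \<open>The preimage of the divisor\<close>

lemma two_element_image_ordered:
  assumes \<Phi>: "bij_betw \<Phi> {..m} X" and Y: "Y = {x, y}" "Y \<subseteq> X" "x \<noteq> y"
  shows "\<exists>p \<in> face_pairs m. Y = {\<Phi> (fst p), \<Phi> (snd p)}"
proof -
  obtain i j where i: "i \<le> m" "\<Phi> i = x" and j: "j \<le> m" "\<Phi> j = y"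
    using \<Phi> Y unfolding bij_betw_def by (metis atMost_iff imageE insert_subset)
  show ?thesis
  proof (cases "i < j")
    case True
    then show ?thesis using i j Y(1) by (intro bexI[of _ "(i, j)"]) (auto simp: face_pairs_def)
  next
    case False
    then have "j < i" using i j Y(3) by (cases "i = j") auto
    then show ?thesis using i j Y(1) by (intro bexI[of _ "(j, i)"]) (auto simp: face_pairs_def)
  qed
qed

context disk_embedded_graph
begin

lemma positive_boundary_incidence:
  assumes e: "e \<in> arcs G" and F: "F \<in> \<F>" and l: "positive_boundary S A F l"
  shows "F \<in> edge_faces e \<Longrightarrow> incidence (\<gamma> e) l = 1 \<or> incidence (\<gamma> e) l = -1"
    and "F \<notin> edge_faces e \<Longrightarrow> incidence (\<gamma> e) l = 0"
proof -
  obtain \<phi> where \<phi>: "positively_oriented_disk S A F \<phi>" "\<forall>z \<in> sphere 0 1. l z = \<phi> z"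
    using l by (auto simp: positive_boundary_def)
  then have disk: "closed_disk S F \<phi>" by (simp add: positively_oriented_disk_def)
  have eq: "incidence (\<gamma> e) l = incidence (\<gamma> e) \<phi>"
    unfolding incidence_def using same_direction_cong[of l \<phi>] \<phi>(2) by simp
  note I = incidence_cases[OF disk_boundary_embedding[OF disk] edge_pathin[OF e] edge_inj[OF e]]
  show "F \<in> edge_faces e \<Longrightarrow> incidence (\<gamma> e) l = 1 \<or> incidence (\<gamma> e) l = -1"
    "F \<notin> edge_faces e \<Longrightarrow> incidence (\<gamma> e) l = 0"
    using I unfolding eq edge_faces_boundary[OF e F disk] by blast+
qed

text \<open>
  This is where the orientation of the surface enters: the signs make the contributions of two
  internal faces cancel in the row sums of \<open>\<tau>(t)\<close>.
\<close>

lemma positive_boundary_incidence_opposite: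
  assumes e: "e \<in> arcs G" and F: "F1 \<in> edge_faces e" "F2 \<in> edge_faces e" "F1 \<noteq> F2"
    and l: "positive_boundary S A F1 l1" "positive_boundary S A F2 l2"
  shows "incidence (\<gamma> e) l1 + incidence (\<gamma> e) l2 = 0"
proof -
  have FF: "F1 \<in> \<F>" "F2 \<in> \<F>" using F by (auto simp: edge_faces_def)
  obtain \<phi>1 where \<phi>1: "positively_oriented_disk S A F1 \<phi>1" "\<forall>z \<in> sphere 0 1. l1 z = \<phi>1 z"
    using l by (auto simp: positive_boundary_def)
  obtain \<phi>2 where \<phi>2: "positively_oriented_disk S A F2 \<phi>2" "\<forall>z \<in> sphere 0 1. l2 z = \<phi>2 z"
    using l by (auto simp: positive_boundary_def)
  have disk: "closed_disk S F1 \<phi>1" "closed_disk S F2 \<phi>2"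
    using \<phi>1 \<phi>2 by (simp_all add: positively_oriented_disk_def)
  have eq: "incidence (\<gamma> e) l1 = incidence (\<gamma> e) \<phi>1" "incidence (\<gamma> e) l2 = incidence (\<gamma> e) \<phi>2"
    unfolding incidence_def using same_direction_cong[of l1 \<phi>1] same_direction_cong[of l2 \<phi>2] \<phi>1(2) \<phi>2(2) by simp_all
  have unit: "incidence (\<gamma> e) \<phi>1 = 1 \<or> incidence (\<gamma> e) \<phi>1 = -1" "incidence (\<gamma> e) \<phi>2 = 1 \<or> incidence (\<gamma> e) \<phi>2 = -1"
    using positive_boundary_incidence(1)[OF e FF(1) l(1) F(1)]
      positive_boundary_incidence(1)[OF e FF(2) l(2) F(2)] unfolding eq .
  show ?thesis
    unfolding eq
    by (rule incidence_opposite[OF surface \<phi>1(1) \<phi>2(1) distinct_disks_disjoint[OF FF F(3) disk]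
          edge_inj[OF e] unit])
qed

text \<open>
  Since distinct faces share at most one edge, an edge is determined by its two faces.
\<close>

lemma edges_of_face_pair_unique:
  assumes common: "\<forall>F1 \<in> \<F>. \<forall>F2 \<in> \<F>. F1 \<noteq> F2 \<longrightarrow> card (common_edges S G \<gamma> F1 F2) \<le> 1"
    and e: "e \<in> arcs G" "e' \<in> arcs G" "edge_faces e = edge_faces e'"
  shows "e = e'"
proof -
  obtain F1 F2 where F: "F1 \<noteq> F2" "edge_faces e = {F1, F2}" using edge_faces_two[OF e(1)] by auto
  let ?E = "common_edges S G \<gamma> F1 F2"
  have m: "F1 \<in> edge_faces e" "F2 \<in> edge_faces e" "F1 \<in> edge_faces e'" "F2 \<in> edge_faces e'"
    using F(2) e(3) by auto
  then have "e \<in> ?E" "e' \<in> ?E" "F1 \<in> \<F>" "F2 \<in> \<F>"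
    using e(1,2) by (simp_all add: common_edges_def edge_faces_def)
  moreover have "finite ?E" using finite_arcs by (simp add: common_edges_def)
  moreover have "card ?E \<le> 1" using common calculation(3,4) F(1) by simp
  ultimately show ?thesis by (metis card_le_Suc0_iff_eq One_nat_def)
qed

text \<open>
  The components to be chosen are those of the pairs of faces at the edges; each of them pulls back
  to one coordinate hyperplane.
\<close>

lemma edge_simplex_preimage:
  fixes c :: "nat \<Rightarrow> nat \<times> nat"
  assumes common: "\<forall>F1 \<in> \<F>. \<forall>F2 \<in> \<F>. F1 \<noteq> F2 \<longrightarrow> card (common_edges S G \<gamma> F1 F2) \<le> 1"
    and es: "distinct es" "set es = arcs G" "n = length es"
    and ext: "ext \<in> \<F>" and F: "bij_betw F {..<m} (\<F> - {ext})"
    and l: "\<forall>k<m. positive_boundary S A (F k) (l k)"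
    and m: "m \<le> ell" and c: "bij_betw c {..<N} (face_pairs m)"
  shows "\<exists>J \<subseteq> {..<N}.
      {t \<in> carrier_vec n. tau_map (eta_matrix ell \<gamma> es l) t \<in> (\<Union>k\<in>J. pair_component ell m (c k))} =
      {t \<in> carrier_vec n. (\<Prod>i<n. vec_index t i) = (0 :: 'k :: field)}"
proof -
  \<comment> \<open>all faces, the external one with the last index\<close>
  define \<Phi> where "\<Phi> k = (if k = m then ext else F k)" for k
  have "bij_betw \<Phi> ({..<m} \<union> {m}) ((\<F> - {ext}) \<union> {ext})"
  proof (rule bij_betw_combine)
    show "bij_betw \<Phi> {..<m} (\<F> - {ext})"
      using F by (rule bij_betw_cong[THEN iffD1, rotated]) (simp add: \<Phi>_def)
  qed (auto simp: \<Phi>_def)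
  moreover have "{..<m} \<union> {m} = {..m}" by auto
  moreover have "(\<F> - {ext}) \<union> {ext} = \<F>" using ext by auto
  ultimately have \<Phi>: "bij_betw \<Phi> {..m} \<F>" by simp
  have \<Phi>F: "\<Phi> k = F k" "F k \<in> \<F>" if "k < m" for k
    using that F by (auto simp: \<Phi>_def bij_betw_def)
  have \<Phi>inj: "i = j" if "\<Phi> i = \<Phi> j" "i \<le> m" "j \<le> m" for i j
    using that \<Phi> by (auto simp: bij_betw_def inj_on_def)
  have arc: "es ! q \<in> arcs G" if "q < n" for q using es that nth_mem by metis
  have "\<exists>p \<in> face_pairs m. edge_faces (es ! q) = {\<Phi> (fst p), \<Phi> (snd p)}" if q: "q < n" for q
  proof -
    obtain F1 F2 where "F1 \<noteq> F2" "edge_faces (es ! q) = {F1, F2}" using edge_faces_two[OF arc[OF q]] by auto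
    then show ?thesis
      by (intro two_element_image_ordered[OF \<Phi>]) (auto simp: edge_faces_def)
  qed
  then obtain ed where ed: "\<And>q. q < n \<Longrightarrow> ed q \<in> face_pairs m"
    "\<And>q. q < n \<Longrightarrow> edge_faces (es ! q) = {\<Phi> (fst (ed q)), \<Phi> (snd (ed q))}"
    by metis
  have edle: "fst (ed q) < snd (ed q)" "snd (ed q) \<le> m" if "q < n" for q
    using ed(1)[OF that] by (auto simp: face_pairs_def)
  have mem: "F k \<in> edge_faces (es ! q) \<longleftrightarrow> k = fst (ed q) \<or> k = snd (ed q)" if "q < n" "k < m" for q k
  proof -
    have "F k \<in> edge_faces (es ! q) \<longleftrightarrow> \<Phi> k = \<Phi> (fst (ed q)) \<or> \<Phi> k = \<Phi> (snd (ed q))"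
      unfolding ed(2)[OF that(1)] \<Phi>F(1)[OF that(2)] by simp
    moreover have "k \<in> {..m}" "fst (ed q) \<in> {..m}" "snd (ed q) \<in> {..m}"
      using that(2) edle[OF that(1)] by auto
    moreover have "inj_on \<Phi> {..m}" using \<Phi> by (rule bij_betw_imp_inj_on)
    ultimately show ?thesis by (simp only: inj_on_eq_iff)
  qed
  define I where "I q k = incidence (\<gamma> (es ! q)) (l k)" for q k
  have edinj: "inj_on ed {..<n}"
  proof (rule inj_onI)
    fix q q' assume q: "q \<in> {..<n}" "q' \<in> {..<n}" "ed q = ed q'"
    have lt: "q < n" "q' < n" using q by auto
    have "edge_faces (es ! q) = edge_faces (es ! q')"
      unfolding ed(2)[OF lt(1)] ed(2)[OF lt(2)] q(3) ..
    then have "es ! q = es ! q'"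
      by (rule edges_of_face_pair_unique[OF common arc[OF lt(1)] arc[OF lt(2)]])
    then show "q = q'" using lt es(1,3) nth_eq_iff_index_eq by metis
  qed
  have unit: "I q k = 1 \<or> I q k = -1" if "q < n" "k < m" "k = fst (ed q) \<or> k = snd (ed q)" for q k
    using positive_boundary_incidence(1)[OF arc[OF that(1)] \<Phi>F(2)[OF that(2)]] l that mem
    by (simp add: I_def)
  have null: "I q k = 0" if "q < n" "k < m" "k \<noteq> fst (ed q)" "k \<noteq> snd (ed q)" for q k
    using positive_boundary_incidence(2)[OF arc[OF that(1)] \<Phi>F(2)[OF that(2)]] l that mem
    by (simp add: I_def)
  have opp: "I q (fst (ed q)) + I q (snd (ed q)) = 0" if q: "q < n" "snd (ed q) < m" for q
  proof -
    have lt: "fst (ed q) < m" "fst (ed q) \<noteq> snd (ed q)" using edle[OF q(1)] q(2) by auto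
    have "F (fst (ed q)) \<noteq> F (snd (ed q))"
      using \<Phi>inj[of "fst (ed q)" "snd (ed q)"] \<Phi>F(1) lt q(2) by auto
    then show ?thesis
      unfolding I_def using mem[OF q(1)] lt q l
      by (intro positive_boundary_incidence_opposite[OF arc[OF q(1)]]) auto
  qed
  let ?\<eta> = "eta_matrix ell \<gamma> es l :: 'k mat"
  have \<eta>: "?\<eta> \<in> carrier_mat n ell" by (simp add: eta_matrix_def es(3))
  have \<eta>I: "?\<eta> $$ (q, k) = of_int (I q k)" if "q < n" "k < m" for q k
    using that m by (simp add: eta_matrix_def es(3) I_def)
  have val: "tau_map ?\<eta> t \<in> pair_component ell m (ed q) \<longleftrightarrow> vec_index t q = 0"
    if t: "t \<in> carrier_vec n" and q: "q < n" for t q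
    using pair_value_tau_map[OF \<eta> t m \<eta>I ed(1) edinj unit null opp q] tau_map_carrier[OF \<eta> t]
    by (simp add: pair_component_def)
  let ?J = "{k. k < N \<and> c k \<in> ed ` {..<n}}"
  have U: "(\<Union>k\<in>?J. pair_component ell m (c k) :: 'k mat set) = (\<Union>q<n. pair_component ell m (ed q))"
  proof -
    have "c ` ?J = ed ` {..<n}"
    proof (intro equalityI subsetI)
      fix p assume p: "p \<in> ed ` {..<n}"
      then have "p \<in> c ` {..<N}" using c ed(1) by (auto simp: bij_betw_def)
      then show "p \<in> c ` ?J" using p by auto
    qed auto
    then show ?thesis by (metis image_image)
  qed
  have "{t \<in> carrier_vec n. tau_map ?\<eta> t \<in> (\<Union>k\<in>?J. pair_component ell m (c k))} =
      {t \<in> carrier_vec n. (\<Prod>i<n. vec_index t i) = 0}"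
    unfolding U using val by auto
  then show ?thesis by (intro exI[of _ ?J]) auto
qed

end

theorem proposition5p2:
  fixes ell g f N :: nat
  assumes "ell \<ge> 1"
    and "ell \<ge> 2 * g + 1"
    and "f = ell - 2 * g + 1"
    and "N = f choose 2"
  shows "\<exists>X :: nat \<Rightarrow> 'k :: field mat set.
    normal_crossings_linear_divisor ell N X \<and>
    X ` {..<N} =
      {{x \<in> carrier_mat ell ell. x $$ (i, j) = 0} | i j. i < j \<and> j < f - 1} \<union>
      {{x \<in> carrier_mat ell ell. (\<Sum>j<f - 1. x $$ (i, j)) = 0} | i. i < f - 1} \<and>
    (\<forall>(S :: 'a topology) \<A> (G :: ('v, 'e) pre_digraph) \<nu> \<gamma> es ext F l n.
       oriented_surface S \<A> \<and> has_genus S g \<and>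
       fin_digraph G \<and> Digraph_Component.connected G \<and>
       closed_2_cell_embedding S G \<nu> \<gamma> \<and>
       has_first_betti_number (subtopology S (graph_image G \<nu> \<gamma>)) ell \<and>
       card (verts G) \<ge> 3 \<and>
       loopfree_digraph G \<and>
       (\<forall>F1 \<in> faces S G \<nu> \<gamma>. \<forall>F2 \<in> faces S G \<nu> \<gamma>.
          F1 \<noteq> F2 \<longrightarrow> card (common_edges S G \<gamma> F1 F2) \<le> 1) \<and>
       distinct es \<and> set es = arcs G \<and> n = length es \<and>
       face_loop_basis S \<A> g G \<nu> \<gamma> ext F l \<longrightarrow>
       card (faces S G \<nu> \<gamma>) = f \<and>
       (\<exists>J \<subseteq> {..<N}.
          {t \<in> carrier_vec n. tau_map (eta_matrix ell \<gamma> es l) t \<in> (\<Union>k\<in>J. X k)} =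
          {t \<in> carrier_vec n. (\<Prod>i<n. vec_index t i) = 0}))"
proof -
  define m where "m = f - 1"
  have f: "f = Suc m" and m: "m \<le> ell" using assms by (auto simp: m_def)
  have "card (face_pairs m) = N" using card_face_pairs[of m] assms(4) f by simp
  then obtain c where c: "bij_betw c {..<N} (face_pairs m)"
    using ex_bij_betw_nat_finite[OF finite_face_pairs[of m]] by (auto simp: lessThan_atLeast0)
  show ?thesis
  proof (rule exI[of _ "\<lambda>k. pair_component ell m (c k)"], intro conjI allI impI)
    show "normal_crossings_linear_divisor ell N (\<lambda>k. pair_component ell m (c k) :: 'k mat set)"
      by (rule normal_crossings_pair_components[OF m c])
    have "(\<lambda>k. pair_component ell m (c k) :: 'k mat set) ` {..<N} = pair_component ell m ` face_pairs m"
      using c unfolding bij_betw_def by (metis image_image)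
    then show "(\<lambda>k. pair_component ell m (c k) :: 'k mat set) ` {..<N} =
      {{x \<in> carrier_mat ell ell. x $$ (i, j) = 0} | i j. i < j \<and> j < f - 1} \<union>
      {{x \<in> carrier_mat ell ell. (\<Sum>j<f - 1. x $$ (i, j)) = 0} | i. i < f - 1}"
      unfolding pair_components_eq m_def .
  next
    fix S :: "'a topology" and \<A> and G :: "('v, 'e) pre_digraph" and \<nu> \<gamma> es ext F l n
    assume H: "oriented_surface S \<A> \<and> has_genus S g \<and>
       fin_digraph G \<and> Digraph_Component.connected G \<and>
       closed_2_cell_embedding S G \<nu> \<gamma> \<and>
       has_first_betti_number (subtopology S (graph_image G \<nu> \<gamma>)) ell \<and>
       card (verts G) \<ge> 3 \<and>
       loopfree_digraph G \<and>
       (\<forall>F1 \<in> faces S G \<nu> \<gamma>. \<forall>F2 \<in> faces S G \<nu> \<gamma>.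
          F1 \<noteq> F2 \<longrightarrow> card (common_edges S G \<gamma> F1 F2) \<le> 1) \<and>
       distinct es \<and> set es = arcs G \<and> n = length es \<and>
       face_loop_basis S \<A> g G \<nu> \<gamma> ext F l"
    let ?f = "card (faces S G \<nu> \<gamma>)"
    from H have surface: "oriented_surface S \<A>" "fin_digraph G" "loopfree_digraph G"
        "closed_2_cell_embedding S G \<nu> \<gamma>"
      and betti: "has_first_betti_number (subtopology S (graph_image G \<nu> \<gamma>)) ell"
      and common: "\<forall>F1 \<in> faces S G \<nu> \<gamma>. \<forall>F2 \<in> faces S G \<nu> \<gamma>.
          F1 \<noteq> F2 \<longrightarrow> card (common_edges S G \<gamma> F1 F2) \<le> 1"
      and es: "distinct es" "set es = arcs G" "n = length es"
      and basis: "face_loop_basis S \<A> g G \<nu> \<gamma> ext F l"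
      by blast+
    from basis have ext: "ext \<in> faces S G \<nu> \<gamma>" and F: "bij_betw F {..<?f - 1} (faces S G \<nu> \<gamma> - {ext})"
      and l: "\<forall>k < ?f - 1. positive_boundary S \<A> (F k) (l k)"
      and hb: "homology_basis (subtopology S (graph_image G \<nu> \<gamma>)) {..<?f - 1 + 2 * g} l"
      unfolding face_loop_basis_def Let_def by blast+
    have "finite (faces S G \<nu> \<gamma> - {ext})" using bij_betw_finite[OF F] by simp
    then have fin: "finite (faces S G \<nu> \<gamma>)" by simp
    have "card {..<?f - 1 + 2 * g} = ell"
      by (rule homology_basis_card[OF hb betti])
    moreover have "?f > 0" using ext fin by (auto simp: card_gt_0_iff)
    ultimately show fcard: "?f = f" using assms by simp
    interpret disk_embedded_graph S \<A> G \<nu> \<gamma>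
      by (rule disk_embedded_graph.intro[OF surface fin])
    have fm: "?f - 1 = m" using fcard f by simp
    show "\<exists>J \<subseteq> {..<N}.
          {t \<in> carrier_vec n. tau_map (eta_matrix ell \<gamma> es l) t \<in> (\<Union>k\<in>J. pair_component ell m (c k))} =
          {t \<in> carrier_vec n. (\<Prod>i<n. vec_index t i) = (0 :: 'k)}"
      by (rule edge_simplex_preimage[OF common es ext F[unfolded fm] l[unfolded fm] m c])
  qed
qed

end
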